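(* $\mu(n)=5$ for every $n\in\{13,14,15\}$.
   Context: A matroid on a finite set $S$ is a family $\mathcal{M}$ of subsets of $S$ with $\emptyset\in\mathcal{M}$, closed under subsets, such that for every $A\subseteq S$ all maximal members of $\mathcal{M}$ contained in $A$ have the same cardinality. For a finite simple graph $G=(V,E)$, $M(G)$ is the family of all matchings (sets of pairwise disjoint edges) of $G$, and $\mu(G)$ is the minimum $m\in\mathbb{N}$ such that $M(G)$ is the intersection $\mathcal{M}_1\cap\dots\cap\mathcal{M}_m$ of $m$ matroids on $E$. For $n\in\mathbb{N}$, $\mu(n)=\max\{\mu(G): G \text{ a finite simple graph with } |V|\le n\}$. *)

theory Defs
  imports Main
begin

definition maximal_member_in :: "'a set set \<Rightarrow> 'a set \<Rightarrow> 'a set \<Rightarrow> bool" where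
  "maximal_member_in M A I \<longleftrightarrow>
     I \<in> M \<and> I \<subseteq> A \<and> (\<forall>J\<in>M. I \<subseteq> J \<and> J \<subseteq> A \<longrightarrow> J = I)"

definition matroid_on :: "'a set \<Rightarrow> 'a set set \<Rightarrow> bool" where
  "matroid_on S M \<longleftrightarrow>
     finite S \<and> M \<subseteq> Pow S \<and> {} \<in> M \<and>
     (\<forall>I\<in>M. \<forall>J. J \<subseteq> I \<longrightarrow> J \<in> M) \<and>
     (\<forall>A. A \<subseteq> S \<longrightarrow>
        (\<forall>I J. maximal_member_in M A I \<longrightarrow> maximal_member_in M A J \<longrightarrow> card I = card J))"

type_synonym 'v graph = "'v set \<times> 'v set set"

definition verts :: "'v graph \<Rightarrow> 'v set" where
  "verts G = fst G"

definition edges :: "'v graph \<Rightarrow> 'v set set" where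
  "edges G = snd G"

definition finite_simple_graph :: "'v graph \<Rightarrow> bool" where
  "finite_simple_graph G \<longleftrightarrow>
     finite (verts G) \<and> edges G \<subseteq> {e. e \<subseteq> verts G \<and> card e = 2}"

definition matchings :: "'v graph \<Rightarrow> 'v set set set" where
  "matchings G = {F. F \<subseteq> edges G \<and> pairwise disjnt F}"

text \<open>
  Intersections are over at least one matroid. Admitting the empty intersection
  (the full power set of the edges) would only change the value for graphs whose
  edges are pairwise disjoint. The minimum exists: for a nonempty vertex set one
  partition matroid per vertex suffices, and for the empty graph the matroid whose
  only member is the empty set does.
\<close>

definition mu_graph :: "'v graph \<Rightarrow> nat" where
  "mu_graph G =
     (LEAST m. m \<ge> 1 \<and>
        (\<exists>M :: nat \<Rightarrow> 'v set set set.
           (\<forall>i\<in>{1..m}. matroid_on (edges G) (M i)) \<and>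
           matchings G = (\<Inter>i\<in>{1..m}. M i)))"

text \<open>
  Every finite graph is isomorphic to one with natural numbers as vertices. The set
  below is finite, since \<^term>\<open>mu_graph G\<close> is at most the larger of 1 and the number
  of vertices.
\<close>

definition mu :: "nat \<Rightarrow> nat" where
  "mu n = Max {mu_graph G | G :: nat graph. finite_simple_graph G \<and> card (verts G) \<le> n}"

end

theory Submission imports Defs begin

text \<open>
  A matroid containing all matchings can be replaced by the partition matroid of its parallel classes,
  which consist of pairwise intersecting edges and hence are stars or triangles. So M(G) is an
  intersection of m matroids iff there are m partitions of the edges into stars and triangles such
  that any two adjacent edges share a class of some partition.

  If only stars occur, then for each vertex the sets of partitions that put its edges into its
  star form an intersecting family of subsets of [m], and the families of different vertices do not
  extend to the same maximal intersecting family. There are 12 such families for m = 4, so 13 vertices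
  are too many, while m = 5 allows for 16 vertices by means of majorities on the odd subsets of [5].

  Triangles do not help: a cover of the complete graph on 13 vertices by four partitions that has as few
  triangles as possible has none. No edge lies in two triangles, because otherwise seven vertices
  would have two of the four colours blocked by outside vertices, and these seven would
  carry a tournament served by two colours only. An isolated triangle can be recoloured away.
\<close>

section \<open>Tournaments served by two colours\<close>

text \<open>A tournament on X in which every path y, x, z of length two has to be served at its middle
  vertex x: by one of two colours that x sends to both y and z, or by a coloured triangle.\<close>

locale two_coloured_tournament =
  fixes X :: "'v set" and R :: "'v \<Rightarrow> 'v \<Rightarrow> bool"
    and B :: "'v \<Rightarrow> 'v \<Rightarrow> 'c set" and T :: "'v \<Rightarrow> 'v \<Rightarrow> 'v \<Rightarrow> 'c set" and i j :: 'c
  assumes tournament: "\<lbrakk>x \<in> X; y \<in> X; x \<noteq> y\<rbrakk> \<Longrightarrow> R x y \<longleftrightarrow> \<not> R y x"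
    and colours: "i \<noteq> j"
    and B_sub: "\<lbrakk>x \<in> X; y \<in> X; x \<noteq> y\<rbrakk> \<Longrightarrow> B x y \<subseteq> {i, j}"
    and B_disj: "\<lbrakk>x \<in> X; y \<in> X; x \<noteq> y\<rbrakk> \<Longrightarrow> B x y \<inter> B y x = {}"
    and T_sub: "\<lbrakk>x \<in> X; y \<in> X; z \<in> X; distinct [x, y, z]\<rbrakk> \<Longrightarrow> T x y z \<subseteq> {i, j}"
    and T_swap: "T x y z = T y x z" and T_rot: "T x y z = T x z y"
    and T_B: "\<lbrakk>x \<in> X; y \<in> X; z \<in> X; distinct [x, y, z]\<rbrakk> \<Longrightarrow> T x y z \<inter> B x y = {}"
    and T_T: "\<lbrakk>x \<in> X; y \<in> X; z \<in> X; w \<in> X; distinct [x, y, z, w]\<rbrakk> \<Longrightarrow> T x y z \<inter> T x y w = {}"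
    and cover: "\<lbrakk>x \<in> X; y \<in> X; z \<in> X; distinct [x, y, z]; R y x; R x z\<rbrakk>
      \<Longrightarrow> B x y \<inter> B x z \<noteq> {} \<or> T x y z \<noteq> {}"
begin

text \<open>Symmetric in \<open>y\<close> and \<open>w\<close>, so that the covering condition can
  be invoked without tracking which end of the path is the in-neighbour of \<open>p\<close>.\<close>

definition opp :: "'v \<Rightarrow> 'v \<Rightarrow> 'v \<Rightarrow> bool" where
  "opp p y w \<longleftrightarrow> R y p \<and> R p w \<or> R w p \<and> R p y"

definition cyclic :: "'v \<Rightarrow> 'v \<Rightarrow> 'v \<Rightarrow> bool" where
  "cyclic x y z \<longleftrightarrow> R x y \<and> R y z \<and> R z x \<or> R y x \<and> R z y \<and> R x z"

lemma cover_opp: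
  assumes "x \<in> X" "y \<in> X" "z \<in> X" "distinct [x, y, z]" "opp x y z"
  shows "B x y \<inter> B x z \<noteq> {} \<or> T x y z \<noteq> {}"
proof -
  have "distinct [x, z, y]" using assms(4) by auto
  then show ?thesis
    using assms cover[of x y z] cover[of x z y] T_rot[of x y z] unfolding opp_def by blast
qed

lemma T_B':
  assumes "x \<in> X" "y \<in> X" "z \<in> X" "distinct [x, y, z]" "c \<in> T x y z"
  shows "c \<notin> B x y" "c \<notin> B y x" "c \<notin> B x z" "c \<notin> B z x" "c \<notin> B y z" "c \<notin> B z y"
  using T_B[of x y z] T_B[of y x z] T_B[of x z y] T_B[of z x y] T_B[of y z x] T_B[of z y x] assms
  by (auto simp: T_swap T_rot)

end

text \<open>A triangle on a transitive triple serves only the middle vertex of the triple, so its colour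
  can be handed to that vertex; triangles matter on cyclic triples only.\<close>

locale cyclic_two_coloured_tournament = two_coloured_tournament +
  assumes T_cyclic: "\<lbrakk>x \<in> X; y \<in> X; z \<in> X; distinct [x, y, z]; T x y z \<noteq> {}\<rbrakk> \<Longrightarrow> cyclic x y z"
    and card_X: "card X \<ge> 7"
begin

lemma fin: "finite X" using card_X card.infinite by fastforce

text \<open>The triangle blocks \<open>c\<close> on the edge from \<open>p\<close> to
  \<open>y\<close>, so the paths through \<open>p\<close> that end in \<open>y\<close> have to use
  \<open>d\<close>. The second witness \<open>w'\<close> excludes service by triangles:
  \<open>d\<close> would lie in two triangles on that edge.\<close>

lemma opp_pair_colour:
  assumes X: "p \<in> X" "y \<in> X" "z \<in> X" "w \<in> X" "w' \<in> X" and d: "distinct [p, y, z, w, w']"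
    and c: "{c, d} = {i, j}" "c \<noteq> d" and T: "c \<in> T p y z"
    and o: "opp p y w" "opp p y w'"
  shows "d \<in> B p w"
proof -
  have *: "T p y v \<subseteq> {d}" if "v \<in> X" "distinct [p, y, z, v]" for v
    using T_T[of p y z v] T_sub[of p y v] that X c T by auto
  have By: "B p y \<subseteq> {d}" using T_B'(1)[of p y z c] B_sub[of p y] X d c T by auto
  show ?thesis
  proof (cases "B p y = {}")
    case True
    then have "T p y w \<noteq> {}" "T p y w' \<noteq> {}" using cover_opp[of p y w] cover_opp[of p y w'] X d o by auto
    then have "d \<in> T p y w" "d \<in> T p y w'" using *[of w] *[of w'] X d by auto
    then show ?thesis using T_T[of p y w w'] X d by auto
  next
    case False
    then have B: "B p y = {d}" using By by auto
    then have "T p y w = {}" using *[of w] X d T_B'(1)[of p y w d] by auto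
    then show ?thesis using cover_opp[of p y w] X d o B by auto
  qed
qed

text \<open>Two triangles on \<open>xz\<close> use up both colours of this edge. Hence every further
  vertex \<open>w\<close> must lie on a path between \<open>x\<close> and \<open>z\<close>. But
  \<open>opp_pair_colour\<close> gives both colours at \<open>x\<close> towards \<open>w\<close>, so
  nothing is left to serve that path at \<open>w\<close>.\<close>

lemma edge_in_one_triangle:
  assumes X: "x \<in> X" "z \<in> X" "y \<in> X" "u \<in> X" and d: "distinct [x, z, y, u]"
    and y: "T x z y \<noteq> {}" 
  shows "T x z u = {}"
proof (rule ccontr)
  assume u: "T x z u \<noteq> {}"
  obtain c where cT: "c \<in> T x z y" using y by auto
  obtain d where dT: "d \<in> T x z u" using u by auto
  have cd: "{c, d} = {i, j}" "c \<noteq> d" "{d, c} = {i, j}"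
    using cT dT T_T[of x z y u] T_sub[of x z y] T_sub[of x z u] X d by auto
  have cy: "cyclic x z y" "cyclic x z u" using T_cyclic X d y u by auto
  have B0: "B x z = {}" "B z x = {}"
    using cT dT T_B'(1,2)[of x z y c] T_B'(1,2)[of x z u d] B_sub[of x z] B_sub[of z x] X d
    unfolding cd(1)[symmetric] by auto
  have T0: "T x z w = {}" if "w \<in> X" "w \<notin> {x, z, y, u}" for w
    using T_T[of x z w y] T_T[of x z w u] T_sub[of x z w] that X d cT dT
    unfolding cd(1)[symmetric] by auto
  have nopp: "\<not> opp x z w" "\<not> opp z x w" if "w \<in> X" "w \<notin> {x, z, y, u}" for w
    using cover_opp[of x z w] cover_opp[of z x w] T0[OF that] B0 that X d T_swap[of x z w] by auto
  have opx: "opp x y w" "opp x u w" "opp z y w" "opp z u w" "opp w x z"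
    if w: "w \<in> X" "w \<notin> {x, z, y, u}" for w
    using nopp[OF w] cy tournament[of x z] tournament[of x w] tournament[of z w] w X d
    unfolding cyclic_def opp_def by auto
  have "card (X - {x, z, y, u}) \<ge> 3"
    using card_X diff_card_le_card_Diff[of "{x, z, y, u}" X] d by (auto simp: card_insert_if)
  then have "\<not> card (X - {x, z, y, u}) \<le> Suc 0" by simp
  then obtain w w' where w: "w \<in> X" "w' \<in> X" "w \<notin> {x, z, y, u}" "w' \<notin> {x, z, y, u}" "w \<noteq> w'"
    using card_le_Suc0_iff_eq[of "X - {x, z, y, u}"] fin by blast
  have 1: "d \<in> B x w" using opp_pair_colour[of x y z w w' c d] opx w X d cT cd by (auto simp: T_rot)
  have 2: "c \<in> B x w" using opp_pair_colour[of x u z w w' d c] opx w X d dT cd by (auto simp: T_rot)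
  have "B w x = {}" using 1 2 B_disj[of x w] B_sub[of w x] w X unfolding cd(1)[symmetric] by auto
  then show False
    using cover_opp[of w x z] opx(5)[of w] w X d T0[of w] T_swap[of w x z] T_rot[of x w z] by auto
qed

text \<open>A triangle of colour \<open>c\<close> leaves only the other colour \<open>e\<close> on
  its sides. This forces all outside vertices onto the same side of all three corners, with
  \<open>e\<close> spent on the edges to the corners and \<open>c\<close> on the edges among the
  outside vertices. A path through four outside vertices then needs \<open>e\<close> twice on its
  middle edge.\<close>

lemma no_triangles:
  assumes X: "x \<in> X" "y \<in> X" "z \<in> X" and d: "distinct [x, y, z]"
  shows "T x y z = {}"
proof (rule ccontr)
  assume "T x y z \<noteq> {}"
  then have "\<exists>x y z. x \<in> X \<and> y \<in> X \<and> z \<in> X \<and> distinct [x, y, z] \<and> T x y z \<noteq> {} \<and>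
      R x y \<and> R y z \<and> R z x"
    using T_cyclic[OF X d] X d T_rot T_swap unfolding cyclic_def by (metis distinct_length_2_or_more)
  then obtain x y z where X: "x \<in> X" "y \<in> X" "z \<in> X" and d: "distinct [x, y, z]"
    and T: "T x y z \<noteq> {}" and R: "R x y" "R y z" "R z x" by blast
  obtain c where cT: "c \<in> T x y z" using T by auto
  obtain e where ce: "{c, e} = {i, j}" "c \<noteq> e" using T_sub[OF X d] cT colours by blast
  define W where "W = X - {x, y, z}"
  have cardW: "card W \<ge> 4"
    unfolding W_def using card_X diff_card_le_card_Diff[of "{x, y, z}" X] d by (auto simp: card_insert_if)
  have finW: "finite W" using fin W_def by auto
  have T0: "T p q w = {}" if w: "w \<in> W" and pq: "p \<in> {x, y, z}" "q \<in> {x, y, z}" "p \<noteq> q" for p q w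
  proof -
    have "T x y w = {}" using edge_in_one_triangle[of x y z w] T w X d W_def by auto
    moreover have "T y z w = {}"
      using edge_in_one_triangle[of y z x w] T w X d W_def T_swap[of x y z] T_rot[of y x z] by auto
    moreover have "T x z w = {}"
      using edge_in_one_triangle[of x z y w] T w X d W_def T_rot[of x y z] by auto
    ultimately show ?thesis using pq T_swap by (auto; metis)
  qed
  have cB: "B p q \<subseteq> {e}" if "p \<in> {x, y, z}" "q \<in> {x, y, z}" "p \<noteq> q" for p q
    using T_B'[OF X d cT] B_sub[of p q] that X d unfolding ce(1)[symmetric] by auto
  have loss: "B p q = {} \<or> B q p = {}" if "p \<in> {x, y, z}" "q \<in> {x, y, z}" "p \<noteq> q" for p q
    using cB[of p q] cB[of q p] B_disj[of p q] that X by auto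
  have side: "\<not> opp p q w" if "B p q = {}" "w \<in> W" "p \<in> {x, y, z}" "q \<in> {x, y, z}" "p \<noteq> q" for p q w
    using cover_opp[of p q w] T0[of w p q] that X W_def by auto
  have eB: "e \<in> B p w" if "opp p q w" "w \<in> W" "p \<in> {x, y, z}" "q \<in> {x, y, z}" "p \<noteq> q" for p q w
    using cover_opp[of p q w] cB[of p q] T0[of w p q] that X W_def by auto
  obtain w0 where w0: "w0 \<in> W" using cardW by fastforce
  have tw: "R p w \<longleftrightarrow> \<not> R w p" if "p \<in> {x, y, z}" "w \<in> W" for p w
    using tournament[of p w] that X W_def by auto
  \<comment> \<open>One end of each side sends no colour to the other end; by \<open>side\<close>
    that end has all of \<open>W\<close> on the same side as the other end. Going round the cycle
    makes the three alternatives agree.\<close>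
  have 1: "(\<forall>w\<in>W. R x w) \<or> (\<forall>w\<in>W. R w y)"
    using loss[of x y] side[of x y] side[of y x] R tw d unfolding opp_def by auto
  have 2: "(\<forall>w\<in>W. R y w) \<or> (\<forall>w\<in>W. R w z)"
    using loss[of y z] side[of y z] side[of z y] R tw d unfolding opp_def by auto
  have 3: "(\<forall>w\<in>W. R z w) \<or> (\<forall>w\<in>W. R w x)"
    using loss[of z x] side[of z x] side[of x z] R tw d unfolding opp_def by auto
  have "\<exists>b. \<forall>p\<in>{x, y, z}. \<forall>w\<in>W. R p w = b"
  proof (cases "R x w0")
    case True
    then have "\<forall>w\<in>W. R z w" "\<forall>w\<in>W. R y w" "\<forall>w\<in>W. R x w" using 1 2 3 tw w0 by auto
    then show ?thesis by auto
  next
    case False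
    then have "\<forall>w\<in>W. R w y" "\<forall>w\<in>W. R w z" "\<forall>w\<in>W. R w x" using 1 2 3 tw w0 by auto
    then show ?thesis using tw by auto
  qed
  then obtain b where b: "\<And>p w. p \<in> {x, y, z} \<Longrightarrow> w \<in> W \<Longrightarrow> R p w = b" by blast
  have eW: "e \<in> B p w" if "p \<in> {x, y, z}" "w \<in> W" for p w
  proof -
    have "opp p x w \<and> p \<noteq> x \<or> opp p y w \<and> p \<noteq> y \<or> opp p z w \<and> p \<noteq> z"
      using that b[OF that] tw[OF that] R d unfolding opp_def by auto
    then show ?thesis using eB that by auto
  qed
  \<comment> \<open>With \<open>e\<close> spent at the corners, only \<open>c\<close> can serve the
    paths from a corner over \<open>w\<close> to \<open>w'\<close>. Triangles could do so for one
    corner only, since all of them share the edge \<open>ww'\<close>.\<close>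
  have cW: "c \<in> B w w'" if w: "w \<in> W" "w' \<in> W" "w \<noteq> w'" "R w w' = b" for w w'
  proof (rule ccontr)
    assume c: "c \<notin> B w w'"
    have "c \<in> T w w' p" if p: "p \<in> {x, y, z}" for p
    proof -
      have pX: "p \<in> X" "distinct [w, w', p]" "w \<in> X" "w' \<in> X" "p \<noteq> w" using p w X W_def by auto
      have "opp w w' p"
        using b[OF p w(1)] tw[OF p w(1)] w tournament[of w w'] pX unfolding opp_def by auto
      moreover have "e \<notin> B w p" using eW[OF p w(1)] B_disj[of w p] pX by auto
      moreover have "e \<notin> T w w' p" using eW[OF p w(1)] T_B'(4)[of w w' p e] pX by auto
      ultimately show ?thesis
        using cover_opp[of w w' p] B_sub[of w w'] T_sub[of w w' p] pX c w unfolding ce(1)[symmetric] by auto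
    qed
    then show False using T_T[of w w' x y] w X d W_def by auto
  qed
  obtain f where f: "f 0 \<in> W" "f 1 \<in> W" "f 2 \<in> W" "f (3::nat) \<in> W" "distinct [f 0, f 1, f 2, f 3]"
  proof -
    obtain V where "V \<subseteq> W" "card V = 4" using cardW by (meson obtain_subset_with_card_n)
    then obtain g where "bij_betw g {0..<4::nat} V" using finW finite_subset ex_bij_betw_nat_finite by metis
    then have "inj_on g {0..<4}" "g ` {0..<4} \<subseteq> W" using \<open>V \<subseteq> W\<close> by (auto simp: bij_betw_def)
    then have "\<And>a b. a < 4 \<Longrightarrow> b < 4 \<Longrightarrow> a \<noteq> b \<Longrightarrow> g a \<noteq> g b" "\<And>a. a < 4 \<Longrightarrow> g a \<in> W"
      by (auto simp: inj_on_def image_subset_iff)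
    then show thesis using that[of g] by simp
  qed
  define Q where "Q p q \<longleftrightarrow> R p q \<noteq> b" for p q
  have Qt: "Q p q \<longleftrightarrow> \<not> Q q p" if "p \<in> W" "q \<in> W" "p \<noteq> q" for p q
    using that tournament[of p q] W_def Q_def by auto
  \<comment> \<open>Every tournament has a Hamiltonian path; four vertices are enough here.\<close>
  obtain p q r s where P: "p \<in> W" "q \<in> W" "r \<in> W" "s \<in> W" "distinct [p, q, r, s]" "Q p q" "Q q r" "Q r s"
    using Qt[of "f 0" "f 1"] Qt[of "f 0" "f 2"] Qt[of "f 0" "f 3"]
      Qt[of "f 1" "f 2"] Qt[of "f 1" "f 3"] Qt[of "f 2" "f 3"] f
    by (smt (verit) distinct_length_2_or_more)
  have PX: "p \<in> X" "q \<in> X" "r \<in> X" "s \<in> X" using P W_def by auto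
  have c: "c \<in> B q p" "c \<in> B r q" "c \<in> B s r"
    using cW[of q p] cW[of r q] cW[of s r] P Q_def tournament[of p q] tournament[of q r] tournament[of r s] PX by auto
  have "opp q p r" "opp r q s"
    using P Q_def tournament[of p q] tournament[of q r] tournament[of r s] PX unfolding opp_def by auto
  then have "B q p \<inter> B q r \<noteq> {} \<or> T q p r \<noteq> {}" "B r q \<inter> B r s \<noteq> {} \<or> T r q s \<noteq> {}"
    using cover_opp[of q p r] cover_opp[of r q s] P PX by auto
  moreover have "c \<notin> T q p r" "c \<notin> T r q s" "c \<notin> B q r" "c \<notin> B r s"
    using c T_B'(1)[of q p r c] T_B'(1)[of r q s c] B_disj[of q r] B_disj[of r s] P PX by auto
  ultimately have "e \<in> B q r \<or> e \<in> T q p r" "e \<in> B r q \<or> e \<in> T r q s"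
    using B_sub[of q r] B_sub[of r q] T_sub[of q p r] T_sub[of r q s] P PX B_sub[of q p]
    unfolding ce(1)[symmetric] by auto
  then show False
    using B_disj[of q r] T_B'(3,4)[of q p r e] T_B'(1,2)[of r q s e] T_T[of q r p s]
      T_rot[of q p r] T_swap[of r q s] P PX by auto
qed

text \<open>Without triangles a vertex that has both an in- and an out-neighbour either sends colour i
  to everyone, or sends j to everyone, or sends both colours to all of its out-neighbours, or to all
  of its in-neighbours. No two vertices can be of the same kind.\<close>

lemma impossible: False
proof -
  have cov: "B p y \<inter> B p w \<noteq> {}" if "p \<in> X" "y \<in> X" "w \<in> X" "distinct [p, y, w]" "opp p y w" for p y w
    using cover_opp no_triangles that by blast
  define M where "M = {p \<in> X. (\<exists>y\<in>X - {p}. R y p) \<and> (\<exists>y\<in>X - {p}. R p y)}"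
  define kind where "kind p = (if \<forall>y\<in>X - {p}. i \<in> B p y then 0 else if \<forall>y\<in>X - {p}. j \<in> B p y then 1
    else if \<forall>y\<in>X - {p}. R p y \<longrightarrow> B p y = {i, j} then 2 else (3::nat))" for p
  have ne: "B p y \<noteq> {}" if p: "p \<in> M" "y \<in> X" "y \<noteq> p" for p y
  proof -
    obtain w where "w \<in> X - {p}" "opp p y w"
      using p tournament[of p y] unfolding M_def opp_def by blast
    moreover then have "w \<noteq> y" using tournament[of p y] p unfolding opp_def M_def by auto
    ultimately show ?thesis using cov[of p y w] p unfolding M_def by auto
  qed
  have kinds: "kind p = 0 \<Longrightarrow> \<forall>y\<in>X - {p}. i \<in> B p y" "kind p = 1 \<Longrightarrow> \<forall>y\<in>X - {p}. j \<in> B p y"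
    "kind p = 2 \<Longrightarrow> \<forall>y\<in>X - {p}. R p y \<longrightarrow> B p y = {i, j}" for p
    unfolding kind_def by (simp_all split: if_split_asm)
  \<comment> \<open>\<open>a\<close> receives only \<open>j\<close> and \<open>b\<close> only
    \<open>i\<close>, so they cannot be on opposite sides of \<open>p\<close>. Every vertex on the
    other side must share a colour with both and therefore receives both. The out-neighbour
    \<open>o'\<close> lacks a colour, so that full side is the in-side.\<close>
  have kind3: "B p y = {i, j}" if p: "p \<in> M" "kind p = 3" and y: "y \<in> X" "y \<noteq> p" "R y p" for p y
  proof -
    obtain a where a: "a \<in> X - {p}" "i \<notin> B p a" using p unfolding kind_def by (auto split: if_splits)
    obtain b where b: "b \<in> X - {p}" "j \<notin> B p b" using p unfolding kind_def by (auto split: if_splits)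
    obtain o' where o: "o' \<in> X - {p}" "R p o'" "B p o' \<noteq> {i, j}"
      using p unfolding kind_def by (auto split: if_splits)
    have pX: "p \<in> X" using p M_def by auto
    have Ba: "B p a = {j}" using a ne[of p a] p B_sub[of p a] pX by auto
    have Bb: "B p b = {i}" using b ne[of p b] p B_sub[of p b] pX by auto
    have ab: "a \<noteq> b" using Ba Bb colours by auto
    have "\<not> opp p a b" using cov[of p a b] Ba Bb colours a b pX ab by auto
    then have side: "R p a = R p b" using tournament[of p a] tournament[of p b] a b pX unfolding opp_def by auto
    have full: "B p w = {i, j}" if "w \<in> X - {p}" "R p w \<noteq> R p a" for w
    proof -
      have "opp p w a" "opp p w b" "w \<noteq> a" "w \<noteq> b"
        using that side tournament[of p w] tournament[of p a] tournament[of p b] a b pX unfolding opp_def by auto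
      then show ?thesis using cov[of p w a] cov[of p w b] Ba Bb a b that pX B_sub[of p w] by auto
    qed
    then have "R p o' = R p a" using o by auto
    then show ?thesis using full[of y] o y tournament[of p y] pX by auto
  qed
  have "inj_on kind M"
  proof (rule inj_onI, rule ccontr)
    fix p q assume pq: "p \<in> M" "q \<in> M" "kind p = kind q" "p \<noteq> q"
    have X: "p \<in> X" "q \<in> X" using pq M_def by auto
    have D: "B p q \<inter> B q p = {}" using B_disj X pq by auto
    have N: "B p q \<noteq> {}" "B q p \<noteq> {}" using ne pq X by auto
    have S: "B p q \<subseteq> {i, j}" "B q p \<subseteq> {i, j}" using B_sub X pq by auto
    have "kind p \<in> {0, 1, 2, 3}" unfolding kind_def by simp
    then consider "kind p = 0" | "kind p = 1" | "kind p = 2" | "kind p = 3" by auto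
    then show False
    proof cases
      case 1
      then have "i \<in> B p q" "i \<in> B q p" using pq X kinds(1)[of p] kinds(1)[of q] by auto
      then show False using D by auto
    next
      case 2
      then have "j \<in> B p q" "j \<in> B q p" using pq X kinds(2)[of p] kinds(2)[of q] by auto
      then show False using D by auto
    next
      case 3
      then have "R p q \<longrightarrow> B p q = {i, j}" "R q p \<longrightarrow> B q p = {i, j}"
        using pq X kinds(3)[of p] kinds(3)[of q] by auto
      then show False using D N S tournament[of p q] X pq by auto
    next
      case 4
      then have "R q p \<longrightarrow> B p q = {i, j}" "R p q \<longrightarrow> B q p = {i, j}"
        using kind3[of p q] kind3[of q p] pq X by auto
      then show False using D N S tournament[of p q] X pq by auto
    qed
  qed
  moreover have "kind ` M \<subseteq> {..3}" unfolding kind_def by auto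
  \<comment> \<open>Four kinds, at most one source and at most one sink make at most six
    vertices.\<close>
  ultimately have "card M \<le> 4" using card_inj_on_le[of kind M "{..3}"] by auto
  moreover have "card {p \<in> X. \<forall>y\<in>X - {p}. R p y} \<le> Suc 0"
  proof -
    have "p = q" if "p \<in> {p \<in> X. \<forall>y\<in>X - {p}. R p y}" "q \<in> {p \<in> X. \<forall>y\<in>X - {p}. R p y}" for p q
      using that tournament[of p q] by auto
    then show ?thesis using fin by (subst card_le_Suc0_iff_eq) auto
  qed
  moreover have "card {p \<in> X. \<forall>y\<in>X - {p}. R y p} \<le> Suc 0"
  proof -
    have "p = q" if "p \<in> {p \<in> X. \<forall>y\<in>X - {p}. R y p}" "q \<in> {p \<in> X. \<forall>y\<in>X - {p}. R y p}" for p q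
      using that tournament[of p q] by auto
    then show ?thesis using fin by (subst card_le_Suc0_iff_eq) auto
  qed
  moreover have "card X = card (M \<union> {p \<in> X. \<forall>y\<in>X - {p}. R p y} \<union> {p \<in> X. \<forall>y\<in>X - {p}. R y p})"
    (is "_ = card (M \<union> ?S \<union> ?T)")
  proof -
    have "p \<in> M \<union> ?S \<union> ?T" if pX: "p \<in> X" for p
    proof (rule ccontr)
      assume n: "p \<notin> M \<union> ?S \<union> ?T"
      obtain y where y: "y \<in> X" "y \<noteq> p" "\<not> R p y" using n pX by blast
      obtain z where z: "z \<in> X" "z \<noteq> p" "\<not> R z p" using n pX by blast
      have "R y p" "R p z" using tournament[of p y] tournament[of p z] y z pX by auto
      then show False using n y z pX unfolding M_def by blast
    qed
    moreover have "M \<subseteq> X" "?S \<subseteq> X" "?T \<subseteq> X" unfolding M_def by auto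
    ultimately have "X = M \<union> ?S \<union> ?T" by blast
    then show ?thesis by (rule arg_cong)
  qed
  moreover have "card (M \<union> ?S \<union> ?T) \<le> card M + card ?S + card ?T"
    by (meson card_Un_le add_le_mono1 le_trans)
  ultimately show False using card_X by linarith
qed

end

text \<open>\<open>B'\<close> hands the colour of a transitive triangle to its middle vertex. No
  edge gets the same colour from both ends in this way: the colour determines the third vertex of
  the triangle, and a transitive triple has a single middle vertex.\<close>

lemma (in two_coloured_tournament) card_le_6:
  assumes fin: "finite X" shows "card X \<le> 6"
proof (rule ccontr)
  assume "\<not> card X \<le> 6"
  define B' where "B' x y = B x y \<union> {c. \<exists>z\<in>X - {x, y}. c \<in> T x y z \<and> opp x y z \<and> \<not> cyclic x y z}" for x y
  define T' where "T' x y z = (if cyclic x y z then T x y z else {})" for x y z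
  have T'_T: "T' x y z \<subseteq> T x y z" for x y z unfolding T'_def by auto
  have uniq: "z = z'" if "c \<in> T x y z" "c \<in> T x y z'" "x \<in> X" "y \<in> X" "z \<in> X - {x, y}" "z' \<in> X - {x, y}" "x \<noteq> y"
    for c x y z z' using T_T[of x y z z'] that by auto
  interpret cyc: cyclic_two_coloured_tournament X R B' T' i j
  proof
    fix x y assume xy: "x \<in> X" "y \<in> X" "x \<noteq> y"
    show "R x y \<longleftrightarrow> \<not> R y x" using tournament xy .
    show "B' x y \<subseteq> {i, j}" unfolding B'_def using B_sub[OF xy] T_sub[OF xy(1,2)] xy by auto
    show "B' x y \<inter> B' y x = {}"
    proof (rule ccontr)
      assume "B' x y \<inter> B' y x \<noteq> {}"
      then obtain c where c: "c \<in> B' x y" "c \<in> B' y x" by auto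
      have "c \<notin> B x y" if "c \<in> T x y z" "z \<in> X - {x, y}" for z using T_B'[of x y z c] that xy by auto
      moreover have "c \<notin> B y x" if "c \<in> T x y z" "z \<in> X - {x, y}" for z using T_B'[of x y z c] that xy by auto
      ultimately obtain z z' where z: "z \<in> X - {x, y}" "z' \<in> X - {x, y}" "c \<in> T x y z" "c \<in> T x y z'"
        "opp x y z" "opp y x z'" "\<not> cyclic x y z"
        using c B_disj[of x y] xy T_swap[of x y] unfolding B'_def by auto
      then have "z' = z" using uniq xy by blast
      then show False using z tournament[of x y] tournament[of x z] tournament[of y z] xy
        unfolding opp_def cyclic_def by auto
    qed
  next
    fix x y z assume z: "x \<in> X" "y \<in> X" "z \<in> X" "distinct [x, y, z]"
    show "T' x y z \<subseteq> {i, j}" using T_sub z T'_T by blast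
    show "T' x y z \<inter> B' x y = {}"
      using T_B[OF z] uniq[of _ x y z] z unfolding T'_def B'_def by auto
    show "B' x y \<inter> B' x z \<noteq> {} \<or> T' x y z \<noteq> {}" if R: "R y x" "R x z"
    proof (cases "B x y \<inter> B x z \<noteq> {} \<or> cyclic x y z")
      case True
      then show ?thesis using cover[OF z R] unfolding B'_def T'_def by auto
    next
      case False
      then obtain c where c: "c \<in> T x y z" using cover[OF z R] by auto
      have "\<not> cyclic x z y" using False unfolding cyclic_def by blast
      then have "c \<in> B' x y" "c \<in> B' x z"
        using c False R z T_rot[of x y z] unfolding B'_def opp_def by auto
      then show ?thesis by auto
    qed
    show "cyclic x y z" if "T' x y z \<noteq> {}" using that unfolding T'_def by presburger
  next
    fix x y z
    show "T' x y z = T' y x z" unfolding T'_def cyclic_def using T_swap[of x y z] by auto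
    show "T' x y z = T' x z y" unfolding T'_def cyclic_def using T_rot[of x y z] by auto
  next
    fix x y z w assume "x \<in> X" "y \<in> X" "z \<in> X" "w \<in> X" "distinct [x, y, z, w]"
    then show "T' x y z \<inter> T' x y w = {}" using T_T T'_T by blast
  next
    show "i \<noteq> j" using colours .
    show "7 \<le> card X" using \<open>\<not> card X \<le> 6\<close> by simp
  qed
  show False using cyc.impossible .
qed

section \<open>Covers by stars and triangles\<close>

text \<open>The colours name the equivalence relations. A colour lies in A u v if the class of the edge uv is
  part of a star with centre u, and in T u v w if the edges of the triangle uvw form a class.\<close>

locale star_triangle_cover =
  fixes V :: "'v :: linorder set" and C :: "'c set"
    and A :: "'v \<Rightarrow> 'v \<Rightarrow> 'c set" and T :: "'v \<Rightarrow> 'v \<Rightarrow> 'v \<Rightarrow> 'c set"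
  assumes card_V: "card V \<ge> 13" and card_C: "card C = 4"
    and A_sub: "\<lbrakk>u \<in> V; v \<in> V; u \<noteq> v\<rbrakk> \<Longrightarrow> A u v \<subseteq> C"
    and A_disj: "\<lbrakk>u \<in> V; v \<in> V; u \<noteq> v\<rbrakk> \<Longrightarrow> A u v \<inter> A v u = {}"
    and T_sub: "\<lbrakk>u \<in> V; v \<in> V; w \<in> V; distinct [u, v, w]\<rbrakk> \<Longrightarrow> T u v w \<subseteq> C"
    and T_swap: "T u v w = T v u w" and T_rot: "T u v w = T u w v"
    and T_A: "\<lbrakk>u \<in> V; v \<in> V; w \<in> V; distinct [u, v, w]\<rbrakk> \<Longrightarrow> T u v w \<inter> A u v = {}"
    and T_T: "\<lbrakk>u \<in> V; v \<in> V; w \<in> V; x \<in> V; distinct [u, v, w, x]\<rbrakk> \<Longrightarrow> T u v w \<inter> T u v x = {}"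
    and cover: "\<lbrakk>u \<in> V; v \<in> V; w \<in> V; distinct [u, v, w]\<rbrakk> \<Longrightarrow> A u v \<inter> A u w \<noteq> {} \<or> T u v w \<noteq> {}"
begin

lemma fin_V: "finite V" using card_V card.infinite by fastforce

lemma fin_C: "finite C" using card_C card.infinite by fastforce

lemma T_A':
  assumes "x \<in> V" "y \<in> V" "z \<in> V" "distinct [x, y, z]" "c \<in> T x y z"
  shows "c \<notin> A x y" "c \<notin> A y x" "c \<notin> A x z" "c \<notin> A z x" "c \<notin> A y z" "c \<notin> A z y"
  using T_A[of x y z] T_A[of y x z] T_A[of x z y] T_A[of z x y] T_A[of y z x] T_A[of z y x] assms
  by (auto simp: T_swap T_rot)

text \<open>Otherwise each of the at least eleven other vertices would need a triangle on
  \<open>uv\<close>, all with different colours, and there are only four.\<close>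

lemma A_nonempty:
  assumes "u \<in> V" "v \<in> V" "u \<noteq> v" shows "A u v \<noteq> {}"
proof
  assume e: "A u v = {}"
  define f where "f w = (SOME c. c \<in> T u v w)" for w
  have f: "f w \<in> T u v w" if "w \<in> V - {u, v}" for w
    using cover[of u v w] that assms e unfolding f_def by (auto intro: someI)
  have "inj_on f (V - {u, v})"
  proof (rule inj_onI, rule ccontr)
    fix w x assume "w \<in> V - {u, v}" "x \<in> V - {u, v}" "f w = f x" "w \<noteq> x"
    then show False using f[of w] f[of x] T_T[of u v w x] assms by auto
  qed
  moreover have "f ` (V - {u, v}) \<subseteq> C"
  proof
    fix c assume "c \<in> f ` (V - {u, v})"
    then obtain w where "w \<in> V - {u, v}" "c = f w" by auto
    then show "c \<in> C" using f[of w] T_sub[of u v w] assms by auto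
  qed
  ultimately have "card (V - {u, v}) \<le> 4" using card_inj_on_le fin_C card_C by metis
  then show False using card_V diff_card_le_card_Diff[of "{u, v}" V] assms by auto
qed

text \<open>With the colours i and j taken by the edges to y, two vertices of X have to share out k and l
  among themselves, which orients the edge between them; only i and j are left for the rest.\<close>

lemma dominated_pair_le_6:
  assumes C: "C = {i, j, k, l}" "distinct [i, j, k, l]"
    and X: "X \<subseteq> V" and y: "\<And>x. x \<in> X \<Longrightarrow> y x \<in> V - X" "\<And>x. x \<in> X \<Longrightarrow> {i, j} \<subseteq> A (y x) x"
  shows "card X \<le> 6"
proof -
  have S: "A x (y x) \<subseteq> {k, l}" if "x \<in> X" for x
  proof -
    have "x \<in> V" "y x \<in> V" "x \<noteq> y x" using that X y(1)[OF that] by auto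
    then show ?thesis using y(2)[OF that] A_disj[of x "y x"] A_sub[of x "y x"] unfolding C by auto
  qed
  have Ty: "T p q (y p) \<subseteq> {k, l}" if "p \<in> X" "q \<in> X" "p \<noteq> q" for p q
  proof -
    have *: "p \<in> V" "q \<in> V" "y p \<in> V" "distinct [p, q, y p]" using that X y[of p] by auto
    then show ?thesis using T_A'(4)[OF *] T_sub[OF *] y(2)[of p] that unfolding C by auto
  qed
  have pair: "A p q \<inter> A p (y p) \<noteq> {} \<or> T p q (y p) \<noteq> {}" if "p \<in> X" "q \<in> X" "p \<noteq> q" for p q
    using cover[of p q "y p"] that X y(1)[of p] by fastforce
  \<comment> \<open>If \<open>p\<close> had both colours, the path from \<open>p\<close> over
    \<open>q\<close> to \<open>y q\<close> could be served neither by a star at \<open>q\<close> nor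
    by a triangle.\<close>
  have not_both: "\<not> {k, l} \<subseteq> A p q" if pq: "p \<in> X" "q \<in> X" "p \<noteq> q" for p q
  proof
    assume kl: "{k, l} \<subseteq> A p q"
    have *: "p \<in> V" "q \<in> V" "y q \<in> V" "distinct [q, p, y q]" using that X y[of q] by auto
    have "A q p \<inter> A q (y q) = {}" using kl A_disj[of p q] S[of q] that * by auto
    then obtain c where "c \<in> T q p (y q)" "c \<in> {k, l}" using pair[of q p] Ty[of q p] pq by auto
    then show False using T_A'(2)[of q p "y q" c] * kl by auto
  qed
  \<comment> \<open>If \<open>m\<close> were the colour of a triangle in \<open>X\<close>, then at
    each corner \<open>a\<close> the two paths to \<open>y a\<close> would be left to
    \<open>m'\<close>. A triangle can serve only one of them and blocks \<open>m'\<close> for the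
    other, so \<open>m'\<close> belongs to both stars at \<open>a\<close>. Two corners then claim
    \<open>m'\<close> on their common edge.\<close>
  have no_kl: "m \<notin> T p q r"
    if pqr: "p \<in> X" "q \<in> X" "r \<in> X" "distinct [p, q, r]" and m: "{m, m'} = {k, l}" "m \<noteq> m'" for p q r m m'
  proof
    assume mT: "m \<in> T p q r"
    have *: "m' \<in> A a b" if abc: "a \<in> X" "b \<in> X" "c \<in> X" "distinct [a, b, c]" "m \<in> T a b c" for a b c
    proof -
      have d: "a \<in> V" "b \<in> V" "c \<in> V" "y a \<in> V" "distinct [a, b, c, y a]" using abc X y(1)[of a] by auto
      have mab: "m \<notin> A a b" "m \<notin> A a c" using T_A'[of a b c m] d abc by auto
      have mT: "m \<notin> T a b (y a)" "m \<notin> T a c (y a)"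
        using T_T[of a b c "y a"] T_T[of a c b "y a"] d abc T_rot[of a b c] by auto
      have "m' \<in> A a b \<inter> A a (y a) \<or> m' \<in> T a b (y a)" "m' \<in> A a c \<inter> A a (y a) \<or> m' \<in> T a c (y a)"
        using pair[of a b] pair[of a c] S[of a] Ty[of a b] Ty[of a c] mab mT abc d unfolding m(1)[symmetric] by auto
      moreover have "\<not> (m' \<in> T a b (y a) \<and> m' \<in> T a c (y a))"
        using T_T[of a "y a" b c] T_rot[of a b "y a"] T_rot[of a c "y a"] d by auto
      moreover have "m' \<notin> A a (y a)" if "m' \<in> T a b (y a) \<or> m' \<in> T a c (y a)"
        using that T_A'(3)[of a b "y a" m'] T_A'(3)[of a c "y a" m'] d by auto
      ultimately show ?thesis by blast
    qed
    have "m' \<in> A p q" "m' \<in> A q p" using *[of p q r] *[of q p r] pqr mT T_swap[of p q r] by auto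
    then show False using A_disj[of p q] pqr X by auto
  qed
  \<comment> \<open>Holding \<open>k\<close> orients an edge away from its holder, holding
    \<open>l\<close> towards it. At the middle of a directed path neither colour is then common to
    both edges. \<open>R\<close> breaks ties by the linear order.\<close>
  define Q where "Q p q \<longleftrightarrow> k \<in> A p q \<or> l \<in> A q p" for p q
  define R where "R p q \<longleftrightarrow> Q p q \<or> \<not> Q q p \<and> p < q" for p q
  have QQ: "\<not> (Q p q \<and> Q q p)" if "p \<in> X" "q \<in> X" "p \<noteq> q" for p q
    using not_both[of p q] not_both[of q p] A_disj[of p q] that X unfolding Q_def by auto
  interpret tt: two_coloured_tournament X R "\<lambda>p q. A p q \<inter> {i, j}" "\<lambda>p q r. T p q r \<inter> {i, j}" i j
  proof
    fix x y assume xy: "x \<in> X" "y \<in> X" "x \<noteq> y"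
    show "R x y \<longleftrightarrow> \<not> R y x" using QQ[OF xy] xy unfolding R_def by auto
    show "A x y \<inter> {i, j} \<inter> (A y x \<inter> {i, j}) = {}" using A_disj[of x y] X xy by auto
  next
    fix x y z assume xyz: "x \<in> X" "y \<in> X" "z \<in> X" "distinct [x, y, z]"
    then have V: "x \<in> V" "y \<in> V" "z \<in> V" using X by auto
    show "T x y z \<inter> {i, j} \<inter> (A x y \<inter> {i, j}) = {}" using T_A[of x y z] xyz V by auto
    show "A x y \<inter> {i, j} \<inter> (A x z \<inter> {i, j}) \<noteq> {} \<or> T x y z \<inter> {i, j} \<noteq> {}" if R: "R y x" "R x z"
    proof -
      have "\<not> Q x y" "\<not> Q z x" using R QQ[of x y] QQ[of x z] xyz unfolding R_def by auto
      then have "k \<notin> A x y" "l \<notin> A x z" unfolding Q_def by auto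
      moreover have "k \<notin> T x y z" "l \<notin> T x y z"
        using no_kl[of x y z k l] no_kl[of x y z l k] xyz C(2) by auto
      ultimately show ?thesis
        using cover[OF V xyz(4)] A_sub[of x y] T_sub[OF V xyz(4)] V xyz unfolding C(1) by auto
    qed
  next
    fix x y z w assume "x \<in> X" "y \<in> X" "z \<in> X" "w \<in> X" "distinct [x, y, z, w]"
    then show "T x y z \<inter> {i, j} \<inter> (T x y w \<inter> {i, j}) = {}" using T_T[of x y z w] X by auto
  next
    show "i \<noteq> j" using C(2) by auto
  qed (use T_swap T_rot in \<open>auto\<close>)
  show ?thesis using tt.card_le_6 finite_subset[OF X fin_V] .
qed

text \<open>The two stars take at least one colour each on the edge \<open>uw\<close>, which leaves
  at most two of the four colours for triangles; one of these belongs to \<open>v\<close>.\<close>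

lemma other_triangle_unique:
  assumes V: "u \<in> V" "w \<in> V" "v \<in> V" "distinct [u, w, v]" and T: "T u w v \<noteq> {}"
  shows "card {x \<in> V - {u, w, v}. T u w x \<noteq> {}} \<le> 1"
proof -
  have "x = x'" if x: "x \<in> {x \<in> V - {u, w, v}. T u w x \<noteq> {}}" "x' \<in> {x \<in> V - {u, w, v}. T u w x \<noteq> {}}" for x x'
  proof (rule ccontr)
    assume n: "x \<noteq> x'"
    obtain a b where ab: "a \<in> A u w" "b \<in> A w u" using A_nonempty[of u w] A_nonempty[of w u] V by auto
    obtain c d e where cde: "c \<in> T u w v" "d \<in> T u w x" "e \<in> T u w x'" using x T by auto
    have "distinct [a, b, c, d, e]"
      using ab cde A_disj[of u w] T_A'(1,2)[of u w v c] T_A'(1,2)[of u w x d] T_A'(1,2)[of u w x' e]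
        T_T[of u w v x] T_T[of u w v x'] T_T[of u w x x'] V x n by auto
    moreover have "set [a, b, c, d, e] \<subseteq> C"
      using ab cde A_sub[of u w] A_sub[of w u] T_sub[of u w v] T_sub[of u w x] T_sub[of u w x'] V x by auto
    ultimately have "5 \<le> card C"
      using card_mono[OF fin_C, of "set [a, b, c, d, e]"] distinct_card[of "[a, b, c, d, e]"] by simp
    then show False using card_C by simp
  qed
  moreover have "finite {x \<in> V - {u, w, v}. T u w x \<noteq> {}}" using fin_V by simp
  ultimately show ?thesis unfolding One_nat_def by (subst card_le_Suc0_iff_eq) blast+
qed

end

section \<open>Covers with the fewest triangles have none\<close>

definition triangles :: "'v set \<Rightarrow> ('v \<Rightarrow> 'v \<Rightarrow> 'v \<Rightarrow> 'c set) \<Rightarrow> ('c \<times> 'v \<times> 'v \<times> 'v) set" where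
  "triangles V T = {(c, u, v, w). u \<in> V \<and> v \<in> V \<and> w \<in> V \<and> distinct [u, v, w] \<and> c \<in> T u v w}"

lemma (in star_triangle_cover) finite_triangles: "finite (triangles V T)"
proof (rule finite_subset)
  show "triangles V T \<subseteq> C \<times> V \<times> V \<times> V" unfolding triangles_def using T_sub by blast
qed (use fin_V fin_C in auto)

text \<open>\<open>triangles\<close> lists every coloured triangle in six orders, which scales all
  counts alike and does not affect minimality. \<open>full\<close> makes the colours on an edge
  exhaust \<open>C\<close>, so that one direction of an edge can be computed from the other.\<close>

locale minimal_cover = star_triangle_cover V C A T
  for V :: "'v :: linorder set" and C :: "'c set" and A T +
  assumes minimal: "star_triangle_cover V C A' T' \<Longrightarrow> card (triangles V T) \<le> card (triangles V T')"
    and full: "\<lbrakk>u \<in> V; v \<in> V; u \<noteq> v; c \<in> C; c \<notin> A u v; c \<notin> A v u\<rbrakk> \<Longrightarrow> \<exists>w\<in>V - {u, v}. c \<in> T u v w"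
begin

text \<open>N is a recolouring of the three edges of a triangle that would make the triangle superfluous.\<close>

lemma triangle_not_removable:
  assumes V: "u \<in> V" "v \<in> V" "w \<in> V" and d: "distinct [u, v, w]" and l: "l \<in> T u v w"
    and N_sub: "\<And>p q. \<lbrakk>p \<in> {u, v, w}; q \<in> {u, v, w}; p \<noteq> q\<rbrakk> \<Longrightarrow> N p q \<subseteq> C"
    and N_disj: "\<And>p q. \<lbrakk>p \<in> {u, v, w}; q \<in> {u, v, w}; p \<noteq> q\<rbrakk> \<Longrightarrow> N p q \<inter> N q p = {}"
    and N_T: "\<And>p q x. \<lbrakk>p \<in> {u, v, w}; q \<in> {u, v, w}; p \<noteq> q; x \<in> V - {u, v, w}\<rbrakk> \<Longrightarrow> T p q x \<inter> N p q = {}"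
    and N_T3: "\<And>p q. \<lbrakk>p \<in> {u, v, w}; q \<in> {u, v, w}; p \<noteq> q\<rbrakk> \<Longrightarrow> (T u v w - {l}) \<inter> N p q = {}"
    and N_cover: "\<And>p q x. \<lbrakk>p \<in> {u, v, w}; q \<in> {u, v, w}; p \<noteq> q; x \<in> V - {u, v, w}\<rbrakk>
      \<Longrightarrow> N p q \<inter> A p x \<noteq> {} \<or> T p q x \<noteq> {}"
    and N_cover3: "\<And>p q r. \<lbrakk>p \<in> {u, v, w}; q \<in> {u, v, w}; r \<in> {u, v, w}; distinct [p, q, r]\<rbrakk>
      \<Longrightarrow> N p q \<inter> N p r \<noteq> {} \<or> T u v w \<noteq> {l}"
  shows False
proof -
  define A' where "A' p q = (if p \<in> {u, v, w} \<and> q \<in> {u, v, w} then N p q else A p q)" for p q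
  \<comment> \<open>Comparing sets drops \<open>l\<close> from all orderings of the triple at once,
    which keeps \<open>T'\<close> symmetric.\<close>
  define T' where "T' p q r = (if {p, q, r} = {u, v, w} then T u v w - {l} else T p q r)" for p q r
  have Teq: "T p q r = T u v w" if "{p, q, r} = {u, v, w}" for p q r
  proof -
    have "p \<in> {u, v, w}" "q \<in> {u, v, w}" "r \<in> {u, v, w}" "u \<in> {p, q, r}" "v \<in> {p, q, r}" "w \<in> {p, q, r}"
      using that by auto
    then show ?thesis using d T_swap T_rot by (smt (verit) distinct_length_2_or_more insertE singletonD)
  qed
  have T'_T: "T' p q r \<subseteq> T p q r" for p q r unfolding T'_def using Teq[of p q r] by auto
  have "star_triangle_cover V C A' T'"
  proof
    show "card V \<ge> 13" "card C = 4" using card_V card_C by auto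
  next
    fix p q assume pq: "p \<in> V" "q \<in> V" "p \<noteq> q"
    show "A' p q \<subseteq> C" unfolding A'_def using N_sub A_sub pq by auto
    show "A' p q \<inter> A' q p = {}" unfolding A'_def using N_disj[of p q] A_disj[of p q] pq by auto
  next
    fix p q r assume pqr: "p \<in> V" "q \<in> V" "r \<in> V" "distinct [p, q, r]"
    have three: "{p, q, r} = {u, v, w}" if "p \<in> {u, v, w}" "q \<in> {u, v, w}" "r \<in> {u, v, w}"
      using that pqr(4) d by auto
    show "T' p q r \<subseteq> C" using T'_T T_sub[OF pqr] by blast
    show "T' p q r \<inter> A' p q = {}"
    proof (cases "p \<in> {u, v, w} \<and> q \<in> {u, v, w}")
      case False
      then show ?thesis unfolding A'_def using T'_T[of p q r] T_A[OF pqr] by auto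
    next
      case True
      then have A: "A' p q = N p q" unfolding A'_def by auto
      show ?thesis
      proof (cases "r \<in> {u, v, w}")
        case r: True
        then have "T' p q r = T u v w - {l}" unfolding T'_def using three True by auto
        then show ?thesis using A N_T3[of p q] True pqr by auto
      next
        case r: False
        then have "r \<in> V - {u, v, w}" using pqr by auto
        then show ?thesis using A N_T[of p q r] True pqr T'_T[of p q r] by auto
      qed
    qed
    show "A' p q \<inter> A' p r \<noteq> {} \<or> T' p q r \<noteq> {}"
    proof (cases "p \<in> {u, v, w}")
      case False
      then have "A' p q = A p q" "A' p r = A p r" "T' p q r = T p q r" unfolding A'_def T'_def by auto
      then show ?thesis using cover[OF pqr] by auto
    next
      case p: True
      show ?thesis
      proof (cases "q \<in> {u, v, w}")
        case q: True
        then have A: "A' p q = N p q" unfolding A'_def using p by auto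
        show ?thesis
        proof (cases "r \<in> {u, v, w}")
          case r: True
          then have "{p, q, r} = {u, v, w}" using three p q by auto
          then show ?thesis using N_cover3[of p q r] A p q r l pqr(4) unfolding A'_def T'_def by auto
        next
          case r: False
          then have "r \<in> V - {u, v, w}" "A' p r = A p r" "T' p q r = T p q r"
            using pqr unfolding A'_def T'_def by auto
          then show ?thesis using N_cover[of p q r] A p q pqr by auto
        qed
      next
        case q: False
        then have Aq: "A' p q = A p q" "T' p q r = T p q r" "q \<in> V - {u, v, w}"
          using pqr unfolding A'_def T'_def by auto
        show ?thesis
        proof (cases "r \<in> {u, v, w}")
          case r: True
          then have "A' p r = N p r" using p unfolding A'_def by auto
          then show ?thesis using Aq N_cover[of p r q] p r pqr T_rot[of p q r] by auto
        next
          case r: False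
          then show ?thesis using Aq cover[OF pqr] unfolding A'_def by auto
        qed
      qed
    qed
  next
    fix p q r :: 'v
    have "{p, q, r} = {q, p, r}" "{p, q, r} = {p, r, q}" by auto
    then show "T' p q r = T' q p r" "T' p q r = T' p r q"
      unfolding T'_def using T_swap[of p q r] T_rot[of p q r] by auto
  next
    fix p q r x assume "p \<in> V" "q \<in> V" "r \<in> V" "x \<in> V" "distinct [p, q, r, x]"
    then show "T' p q r \<inter> T' p q x = {}" using T_T[of p q r x] T'_T by blast
  qed
  then have "card (triangles V T) \<le> card (triangles V T')" by (rule minimal)
  moreover have "triangles V T' \<subset> triangles V T"
  proof -
    have "(l, u, v, w) \<in> triangles V T" "(l, u, v, w) \<notin> triangles V T'"
      using V d l unfolding triangles_def T'_def by auto
    moreover have "triangles V T' \<subseteq> triangles V T" unfolding triangles_def using T'_T by auto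
    ultimately show ?thesis by blast
  qed
  ultimately show False using psubset_card_mono[OF finite_triangles, of "triangles V T'"] by simp
qed

end

context minimal_cover
begin

text \<open>If the triangle is needed at u only, its colour can be given to the two edges at u. So a triangle
  of a minimal cover is needed at two of its vertices at least.\<close>

lemma two_critical:
  assumes V: "u \<in> V" "v \<in> V" "w \<in> V" and d: "distinct [u, v, w]" and l: "l \<in> T u v w"
    and v: "A v u \<inter> A v w \<noteq> {} \<or> T u v w \<noteq> {l}" and w: "A w u \<inter> A w v \<noteq> {} \<or> T u v w \<noteq> {l}"
  shows False
proof (rule triangle_not_removable[OF V d l, of "\<lambda>p q. if p = u then A p q \<union> {l} else A p q"])
  note lA = T_A'[OF V d l]
  have lC: "l \<in> C" using T_sub[OF V d] l by auto
  fix p q assume pq: "p \<in> {u, v, w}" "q \<in> {u, v, w}" "p \<noteq> q"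
  then have pqV: "p \<in> V" "q \<in> V" using V by auto
  show "(if p = u then A p q \<union> {l} else A p q) \<subseteq> C" using A_sub[of p q] pqV pq lC by auto
  show "(if p = u then A p q \<union> {l} else A p q) \<inter> (if q = u then A q p \<union> {l} else A q p) = {}"
    using A_disj[of p q] lA pqV pq d by auto
  show "(T u v w - {l}) \<inter> (if p = u then A p q \<union> {l} else A p q) = {}"
    using T_A'[OF V d] pq by auto
  fix x assume x: "x \<in> V - {u, v, w}"
  have "l \<notin> T u v x" "l \<notin> T u w x"
    using T_T[of u v w x] T_T[of u w v x] T_rot[of u v w] V d x l by auto
  then show "T p q x \<inter> (if p = u then A p q \<union> {l} else A p q) = {}"
    using T_A[of p q x] pq pqV x by auto
  show "(if p = u then A p q \<union> {l} else A p q) \<inter> A p x \<noteq> {} \<or> T p q x \<noteq> {}"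
    using cover[of p q x] pq pqV x by auto
next
  fix p q r assume "p \<in> {u, v, w}" "q \<in> {u, v, w}" "r \<in> {u, v, w}" "distinct [p, q, r]"
  then show "(if p = u then A p q \<union> {l} else A p q) \<inter> (if p = u then A p r \<union> {l} else A p r) \<noteq> {}
      \<or> T u v w \<noteq> {l}"
    using v w d by auto
qed

text \<open>With \<open>l\<close> and \<open>k\<close> on triangles, \<open>uv\<close> has just
  \<open>i\<close> left for \<open>u\<close> and \<open>j\<close> for \<open>v\<close>, so every
  further \<open>x\<close> gets \<open>i\<close> from \<open>u\<close> and \<open>j\<close> from
  \<open>v\<close>. The criticality of the two triangles adds the missing colour for almost all
  \<open>x\<close>, and these \<open>x\<close> violate \<open>dominated_pair_le_6\<close>.\<close>

lemma no_double_edge_case: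
  assumes V: "u \<in> V" "v \<in> V" "w \<in> V" "z \<in> V" and d: "distinct [u, v, w, z]"
    and l: "l \<in> T u v w" and k: "k \<in> T u v z"
    and w: "A u v \<inter> A u w = {}" and z: "A u v \<inter> A u z = {} \<or> A v u \<inter> A v z = {}"
  shows False
proof -
  obtain i j where ij: "i \<in> A u v" "j \<in> A v u" using A_nonempty[of u v] A_nonempty[of v u] V d by auto
  have lA: "l \<notin> A u v" "l \<notin> A v u" "l \<notin> A u w" and kA: "k \<notin> A u v" "k \<notin> A v u" "k \<notin> A u z" "k \<notin> A v z"
    using T_A'[of u v w l] T_A'[of u v z k] V d l k by auto
  have dist: "distinct [i, j, k, l]"
    using ij lA kA A_disj[of u v] T_T[of u v w z] V d l k by auto
  have sub: "{i, j, k, l} \<subseteq> C"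
    using ij l k A_sub[of u v] A_sub[of v u] T_sub[of u v w] T_sub[of u v z] V d by auto
  have C: "C = {i, j, k, l}"
    using card_subset_eq[OF fin_C sub] dist card_C by simp
  have Auv: "A u v = {i}" and Avu: "A v u = {j}"
    using ij lA kA A_disj[of u v] A_sub[of u v] A_sub[of v u] V d unfolding C by auto
  have Auw: "A u w \<subseteq> {j, k}" using A_sub[of u w] w Auv lA V d unfolding C by auto
  have Txuv: "T u v x = {}" if x: "x \<in> V - {u, v, w, z}" for x
  proof -
    have "i \<notin> T u v x" "j \<notin> T u v x" using T_A'(1,2)[of u v x] ij x V d by auto
    then show ?thesis using T_sub[of u v x] T_T[of u v w x] T_T[of u v z x] x V d l k unfolding C by auto
  qed
  have base: "i \<in> A u x" "j \<in> A v x" "A x u \<inter> A x v \<noteq> {}" "i \<notin> A x u" "j \<notin> A x v"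
    "A x u \<subseteq> C" "A x v \<subseteq> C" "A u x \<inter> A x u = {}" "A v x \<inter> A x v = {}"
    if x: "x \<in> V - {u, v, w, z}" for x
  proof -
    note e = Txuv[OF x]
    show "i \<in> A u x" using cover[of u v x] e Auv V d x by auto
    show "j \<in> A v x" using cover[of v u x] e T_swap[of u v x] Avu V d x by auto
    show "A x u \<inter> A x v \<noteq> {}" using cover[of x u v] e T_swap[of x u v] T_rot[of u x v] V d x by auto
    show "A u x \<inter> A x u = {}" "A v x \<inter> A x v = {}" using A_disj[of u x] A_disj[of v x] V d x by auto
    then show "i \<notin> A x u" "j \<notin> A x v" using \<open>i \<in> A u x\<close> \<open>j \<in> A v x\<close> by auto
    show "A x u \<subseteq> C" "A x v \<subseteq> C" using A_sub[of x u] A_sub[of x v] V x by auto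
  qed
  define E where "E = {x \<in> V - {u, w, v}. T u w x \<noteq> {}}"
  have E: "card E \<le> 1" unfolding E_def
    using other_triangle_unique[of u w v] V d l T_rot[of u v w] by auto
  have hitw: "A u x \<inter> {j, k} \<noteq> {}" if "x \<in> V - {u, v, w, z} - E" for x
    using cover[of u w x] that Auw V d unfolding E_def by auto
  \<comment> \<open>The bound is 13 - 4 - 1 - 1, just above the 6 of
    \<open>dominated_pair_le_6\<close>.\<close>
  have big: "card (V - {u, v, w, z} - E - F) \<ge> 7" if "card F \<le> 1" "F \<subseteq> V" for F
  proof -
    have "finite E" "finite F" using fin_V that E_def finite_subset by auto
    then have "card V - card {u, v, w, z} \<le> card (V - {u, v, w, z})"
      "card (V - {u, v, w, z}) - card E \<le> card (V - {u, v, w, z} - E)"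
      "card (V - {u, v, w, z} - E) - card F \<le> card (V - {u, v, w, z} - E - F)"
      by (simp_all only: diff_card_le_card_Diff finite.intros)
    moreover have "card {u, v, w, z} = 4" using d by auto
    ultimately show ?thesis using card_V E that by linarith
  qed
  from z show False
  proof
    assume z: "A u v \<inter> A u z = {}"
    define F where "F = {x \<in> V - {u, z, v}. T u z x \<noteq> {}}"
    have F: "card F \<le> 1" unfolding F_def
      using other_triangle_unique[of u z v] V d k T_rot[of u v z] by auto
    have Auz: "A u z \<subseteq> {j, l}" using A_sub[of u z] z Auv kA V d unfolding C by auto
    \<comment> \<open>If \<open>A u x\<close> lacked \<open>j\<close>, it would contain
      \<open>i\<close>, \<open>k\<close> and \<open>l\<close>. Then only \<open>j\<close> would be
      left for \<open>A x u\<close>, but \<open>A x v\<close> does not contain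
      \<open>j\<close>.\<close>
    have "card (V - {u, v, w, z} - E - F) \<le> 6"
    proof (rule dominated_pair_le_6[OF C dist, of _ "\<lambda>_. u"])
      fix x assume x: "x \<in> V - {u, v, w, z} - E - F"
      have "A u x \<inter> {j, l} \<noteq> {}" using cover[of u z x] x Auz V d unfolding F_def by auto
      then show "{i, j} \<subseteq> A u x" using hitw[of x] base[of x] x unfolding C by auto
    qed (use V in auto)
    moreover have "F \<subseteq> V" unfolding F_def by auto
    ultimately show False using big[of F] F by simp
  next
    assume z: "A v u \<inter> A v z = {}"
    define F where "F = {x \<in> V - {v, z, u}. T v z x \<noteq> {}}"
    have F: "card F \<le> 1" unfolding F_def
      using other_triangle_unique[of v z u] V d k T_swap[of u v z] T_rot[of v u z] by auto
    have Avz: "A v z \<subseteq> {i, l}" using A_sub[of v z] z Avu kA V d unfolding C by auto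
    \<comment> \<open>If neither \<open>u\<close> nor \<open>v\<close> sent both \<open>i\<close>
      and \<open>j\<close> to \<open>x\<close>, then \<open>k\<close> would be in
      \<open>A u x\<close> and \<open>l\<close> in \<open>A v x\<close>, and \<open>A x u\<close>
      and \<open>A x v\<close> could not meet.\<close>
    have "card (V - {u, v, w, z} - E - F) \<le> 6"
    proof (rule dominated_pair_le_6[OF C dist, of _ "\<lambda>x. if {i, j} \<subseteq> A u x then u else v"])
      fix x assume x: "x \<in> V - {u, v, w, z} - E - F"
      have "A v x \<inter> {i, l} \<noteq> {}" using cover[of v z x] x Avz V d unfolding F_def by auto
      then show "{i, j} \<subseteq> A (if {i, j} \<subseteq> A u x then u else v) x"
        using hitw[of x] base[of x] x unfolding C by auto
    qed (use V in auto)
    moreover have "F \<subseteq> V" unfolding F_def by auto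
    ultimately show False using big[of F] F by simp
  qed
qed

text \<open>If both ends of \<open>uv\<close> were served by stars, only \<open>w\<close> could need
  the triangle; if the triangle had a second colour, no corner would need \<open>l\<close>. Either
  contradicts \<open>two_critical\<close>.\<close>

lemma critical_on_edge:
  assumes V: "u \<in> V" "v \<in> V" "w \<in> V" and d: "distinct [u, v, w]" and l: "l \<in> T u v w"
  shows "A u v \<inter> A u w = {} \<or> A v u \<inter> A v w = {}" and "T u v w = {l}"
proof -
  have eq: "T w u v = T u v w" using T_swap T_rot by metis
  have d': "distinct [w, u, v]" using d by auto
  show "A u v \<inter> A u w = {} \<or> A v u \<inter> A v w = {}"
    using two_critical[of w u v l] V d' l unfolding eq by (auto simp: Int_commute)
  show "T u v w = {l}" using two_critical[of u v w l] V d l by auto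
qed

text \<open>Each of two triangles on \<open>uv\<close> is critical at \<open>u\<close> or at
  \<open>v\<close>; after exchanging \<open>u\<close> and \<open>v\<close> if necessary the first is
  critical at \<open>u\<close>.\<close>

lemma edge_in_one_triangle:
  assumes V: "u \<in> V" "v \<in> V" "w \<in> V" "z \<in> V" and d: "distinct [u, v, w, z]" and l: "l \<in> T u v w"
  shows "T u v z = {}"
proof (rule ccontr)
  assume "T u v z \<noteq> {}"
  then obtain k where k: "k \<in> T u v z" by auto
  have "A u v \<inter> A u w = {} \<or> A v u \<inter> A v w = {}" "A u v \<inter> A u z = {} \<or> A v u \<inter> A v z = {}"
    using critical_on_edge(1)[of u v w l] critical_on_edge(1)[of u v z k] V d l k by auto
  moreover have "l \<in> T v u w" "k \<in> T v u z" "distinct [v, u, w, z]" using l k T_swap d by auto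
  ultimately show False
    using no_double_edge_case[OF V d l k] no_double_edge_case[of v u w z l k] V by auto
qed

text \<open>All other vertices now meet both colour sets at each corner of the triangle, which leaves enough
  freedom to redistribute the four colours on its three edges without the triangle.\<close>

lemma rewire:
  assumes V: "u \<in> V" "v \<in> V" "w \<in> V" and d: "distinct [u, v, w]" and l: "l \<in> T u v w"
    and u: "A u v \<inter> A u w = {}" and v: "A v u \<inter> A v w = {}" and i: "A u v = {i}"
  shows False
proof -
  have perm: "T u w v = T u v w" "T v w u = T u v w" "T v u w = T u v w" "T w u v = T u v w" "T w v u = T u v w"
    using T_swap T_rot by metis+
  have Tuvw: "T u v w = {l}" using critical_on_edge(2)[OF V d l] .
  have T0: "T p q x = {}" if pq: "p \<in> {u, v, w}" "q \<in> {u, v, w}" "p \<noteq> q" and x: "x \<in> V - {u, v, w}" for p q x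
    using edge_in_one_triangle[of u v w x] edge_in_one_triangle[of u w v x] edge_in_one_triangle[of v w u x]
      edge_in_one_triangle[of v u w x] edge_in_one_triangle[of w u v x] edge_in_one_triangle[of w v u x]
      pq x V d l unfolding perm by auto
  \<comment> \<open>By \<open>full\<close> every colour other than \<open>l\<close> is in a star on
    each side, since \<open>uvw\<close> is the only triangle there.\<close>
  have AC: "A p q \<union> A q p = C - {l}" "A p q \<inter> A q p = {}" "A p q \<noteq> {}"
    if pq: "p \<in> {u, v, w}" "q \<in> {u, v, w}" "p \<noteq> q" for p q
  proof -
    have pqV: "p \<in> V" "q \<in> V" using pq V by auto
    show "A p q \<inter> A q p = {}" "A p q \<noteq> {}" using A_disj A_nonempty pqV pq by auto
    have "c = l" if c: "c \<in> C" "c \<notin> A p q" "c \<notin> A q p" for c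
    proof -
      obtain x where "x \<in> V - {p, q}" "c \<in> T p q x" using full[of p q c] c pqV pq by blast
      then show ?thesis using T0[of p q x] pq Tuvw perm by (cases "x \<in> {u, v, w}") auto
    qed
    moreover have "l \<notin> A p q \<union> A q p" using T_A'[OF V d l] pq by auto
    ultimately show "A p q \<union> A q p = C - {l}" using A_sub[of p q] A_sub[of q p] pqV pq by auto
  qed
  have compl: "A q p = C - {l} - A p q" if "p \<in> {u, v, w}" "q \<in> {u, v, w}" "p \<noteq> q" for p q
    using AC[OF that] by blast
  have meets: "A p q \<inter> A p x \<noteq> {}"
    if "p \<in> {u, v, w}" "q \<in> {u, v, w}" "p \<noteq> q" "x \<in> V - {u, v, w}" for p q x
    using cover[of p q x] T0[OF that] that V by auto
  have lC: "l \<in> C" using T_sub[OF V d] l by auto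
  have iC: "i \<in> C" "i \<noteq> l" using AC[of u v] i d by auto
  have "card (C - {i, l}) = 2" using card_C fin_C lC iC by (simp add: card_Diff_subset)
  then obtain j0 k0 where jk0: "C - {i, l} = {j0, k0}" "j0 \<noteq> k0" by (meson card_2_iff)
  \<comment> \<open>The colour sets at \<open>v\<close> and \<open>w\<close> on \<open>uv\<close>
    and \<open>vw\<close> are now forced. Only \<open>A u w\<close> is open, and up to exchanging
    \<open>j\<close> and \<open>k\<close> it is \<open>{j}\<close> or \<open>{j, k}\<close>.\<close>
  have Avu: "A v u = C - {i, l}" using AC[of u v] i d by auto
  have Avw: "A v w = {i}" using AC[of v w] Avu v d by auto
  have Awv: "A w v = C - {i, l}" using AC[of v w] Avw d by auto
  have Auw: "A u w \<subseteq> C - {i, l}" "A u w \<noteq> {}" using AC[of u w] u i d by auto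
  have "A u w = {j0} \<or> A u w = {k0} \<or> A u w = {j0, k0}" using Auw unfolding jk0(1) by auto
  then obtain j k where jk: "C - {i, l} = {j, k}" "j \<noteq> k" and cases: "A u w = {j} \<or> A u w = {j, k}"
    using jk0 by (metis insert_commute)
  have C: "C = {i, j, k, l}" using jk lC iC by auto
  have dist: "distinct [i, j, k, l]" using jk iC by auto
  from cases show False
  proof
    assume j: "A u w = {j}"
    have "A w u = C - {l} - A u w" using compl[of u w] d by auto
    then have Awu: "A w u = {i, k}" unfolding j C using dist by auto
    \<comment> \<open>Each \<open>N p q\<close> contains one of the two old colour sets at
      \<open>p\<close>, which all outside vertices meet by \<open>meets\<close>. The corners
      \<open>u\<close>, \<open>v\<close>, \<open>w\<close> are served by \<open>j\<close>,
      \<open>i\<close> and \<open>k\<close>.\<close>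
    define N where "N p q = (if p = u then if q = v then {j} else {j, l}
      else if p = v then if q = u then {i, k, l} else {i, l} else if q = u then {i, k} else {j, k})" for p q
    show False
    proof (rule triangle_not_removable[OF V d l, of N])
      fix p q assume pq: "p \<in> {u, v, w}" "q \<in> {u, v, w}" "p \<noteq> q"
      then show "N p q \<subseteq> C" "N p q \<inter> N q p = {}" "(T u v w - {l}) \<inter> N p q = {}"
        unfolding N_def C Tuvw using d dist by auto
      fix x assume x: "x \<in> V - {u, v, w}"
      show "T p q x \<inter> N p q = {}" using T0[OF pq x] by auto
      have "N p q \<inter> A p x \<noteq> {}"
        using meets[of u v x] meets[of u w x] meets[of v u x] meets[of v w x] meets[of w u x] meets[of w v x]
          pq x d unfolding i j Avu Avw Awv Awu jk(1) N_def by auto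
      then show "N p q \<inter> A p x \<noteq> {} \<or> T p q x \<noteq> {}" ..
    next
      fix p q r assume "p \<in> {u, v, w}" "q \<in> {u, v, w}" "r \<in> {u, v, w}" "distinct [p, q, r]"
      then show "N p q \<inter> N p r \<noteq> {} \<or> T u v w \<noteq> {l}" unfolding N_def using d by auto
    qed
  next
    assume j: "A u w = {j, k}"
    have "A w u = C - {l} - A u w" using compl[of u w] d by auto
    then have Awu: "A w u = {i}" unfolding j C using dist by auto
    \<comment> \<open>The same principle: each \<open>N p q\<close> contains an old colour set at
      \<open>p\<close>. Here \<open>i\<close> serves \<open>u\<close>, \<open>j\<close> serves
      \<open>v\<close>, and the released colour \<open>l\<close> serves \<open>w\<close>.\<close>
    define N where "N p q = (if p = u then {i} else if p = v then if q = u then {j, k, l} else {j, k}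
      else if q = u then {j, k, l} else {i, l})" for p q
    show False
    proof (rule triangle_not_removable[OF V d l, of N])
      fix p q assume pq: "p \<in> {u, v, w}" "q \<in> {u, v, w}" "p \<noteq> q"
      then show "N p q \<subseteq> C" "N p q \<inter> N q p = {}" "(T u v w - {l}) \<inter> N p q = {}"
        unfolding N_def C Tuvw using d dist by auto
      fix x assume x: "x \<in> V - {u, v, w}"
      show "T p q x \<inter> N p q = {}" using T0[OF pq x] by auto
      have "N p q \<inter> A p x \<noteq> {}"
        using meets[of u v x] meets[of u w x] meets[of v u x] meets[of v w x] meets[of w u x] meets[of w v x]
          pq x d unfolding i j Avu Avw Awv Awu jk(1) N_def by auto
      then show "N p q \<inter> A p x \<noteq> {} \<or> T p q x \<noteq> {}" ..
    next
      fix p q r assume "p \<in> {u, v, w}" "q \<in> {u, v, w}" "r \<in> {u, v, w}" "distinct [p, q, r]"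
      then show "N p q \<inter> N p r \<noteq> {} \<or> T u v w \<noteq> {l}" unfolding N_def using d by auto
    qed
  qed
qed

text \<open>Every side has a critical corner, so two corners are critical. The side joining them has
  at most three colours besides that of the triangle, so one of its two nonempty colour sets is a
  singleton, as \<open>rewire\<close> demands.\<close>

lemma no_triangles:
  assumes V: "u \<in> V" "v \<in> V" "w \<in> V" and d: "distinct [u, v, w]"
  shows "T u v w = {}"
proof (rule ccontr)
  assume "T u v w \<noteq> {}"
  then obtain l where l: "l \<in> T u v w" by auto
  have two: False if V: "u \<in> V" "v \<in> V" "w \<in> V" and d: "distinct [u, v, w]" and l: "l \<in> T u v w"
    and u: "A u v \<inter> A u w = {}" and v: "A v u \<inter> A v w = {}" for u v w
  proof -
    have "l \<notin> A u v \<union> A v u" "l \<in> C" using T_A'[OF V d l] T_sub[OF V d] l by auto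
    then have "A u v \<union> A v u \<subseteq> C - {l}" using A_sub[of u v] A_sub[of v u] V d by auto
    then have "card (A u v \<union> A v u) \<le> 3"
      using card_mono[of "C - {l}" "A u v \<union> A v u"] fin_C card_C \<open>l \<in> C\<close> by simp
    moreover have fin: "finite (A u v)" "finite (A v u)" using A_sub[of u v] A_sub[of v u] V d fin_C finite_subset by auto
    moreover have "card (A u v \<union> A v u) = card (A u v) + card (A v u)"
      using A_disj[of u v] V d fin by (intro card_Un_disjoint) auto
    moreover have "card (A u v) \<noteq> 0" "card (A v u) \<noteq> 0" using A_nonempty[of u v] A_nonempty[of v u] V d fin by auto
    ultimately have "card (A u v) = 1 \<or> card (A v u) = 1" by linarith
    then consider i where "A u v = {i}" | i where "A v u = {i}" by (meson card_1_singletonE)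
    then show False
    proof cases
      case 1 then show False using rewire[OF V d l u v] by auto
    next
      case 2
      moreover have "distinct [v, u, w]" "l \<in> T v u w" using d l T_swap by auto
      ultimately show False using rewire[of v u w l i] V u v by auto
    qed
  qed
  have perm: "T u w v = T u v w" "T v w u = T u v w" using T_swap T_rot by metis+
  have d': "distinct [u, w, v]" "distinct [v, w, u]" using d by auto
  have "A u v \<inter> A u w = {} \<or> A v u \<inter> A v w = {}" "A u w \<inter> A u v = {} \<or> A w u \<inter> A w v = {}"
    "A v w \<inter> A v u = {} \<or> A w v \<inter> A w u = {}"
    using critical_on_edge(1)[of u v w l] critical_on_edge(1)[of u w v l] critical_on_edge(1)[of v w u l] V d d' l
    unfolding perm by auto
  then show False
    using two[of u v w] two[of u w v] two[of v w u] V d d' l unfolding perm by (auto simp: Int_commute)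
qed

end

section \<open>Intersecting families\<close>

text \<open>The twelve maximal intersecting families on a four-element set, as majority systems: the weights
  are 1 on x and 0 elsewhere, or 0 on x and 1 elsewhere, or 2 on x and 1 elsewhere.\<close>

fun maximal_family :: "'c set \<Rightarrow> nat \<times> 'c \<Rightarrow> 'c set set" where
  "maximal_family C (t, x) =
     (if t = 0 then {S. x \<in> S} else if t = 1 then {S. 2 \<le> card (S \<inter> (C - {x}))}
      else {S. x \<in> S \<and> 2 \<le> card S \<or> 3 \<le> card S})"

text \<open>Disjoint sets cannot both have a majority of the weight.\<close>

lemma maximal_family_intersecting:
  assumes C: "card C = 4" "x \<in> C" and S: "S \<subseteq> C" "S' \<subseteq> C"
    and "S \<in> maximal_family C (t, x)" "S' \<in> maximal_family C (t, x)"
  shows "S \<inter> S' \<noteq> {}"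
proof
  assume disj: "S \<inter> S' = {}"
  have fin: "finite C" using C card.infinite by fastforce
  then have finS: "finite S" "finite S'" using S finite_subset by auto
  have "card S + card S' = card (S \<union> S')" using disj finS by (simp add: card_Un_disjoint)
  also have "\<dots> \<le> 4" using card_mono[OF fin, of "S \<union> S'"] S C by simp
  finally have 1: "card S + card S' \<le> 4" .
  have "card (S \<inter> (C - {x})) + card (S' \<inter> (C - {x})) = card (S \<inter> (C - {x}) \<union> S' \<inter> (C - {x}))"
    using disj finS by (subst card_Un_disjoint) auto
  also have "\<dots> \<le> card (C - {x})" using fin by (intro card_mono) auto
  finally have 2: "card (S \<inter> (C - {x})) + card (S' \<inter> (C - {x})) \<le> 3" using C fin by simp
  show False using assms(5,6) 1 2 disj by (auto split: if_splits)
qed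

text \<open>A singleton in \<open>F\<close> lies in all members. Without singletons, either some
  \<open>x\<close> is common to all pairs in \<open>F\<close>, or the pairs contain a triangle
  \<open>ab\<close>, \<open>bc\<close>, \<open>ac\<close>; every member meets all three and so
  contains two of \<open>a\<close>, \<open>b\<close>, \<open>c\<close>.\<close>

lemma intersecting_family_extends:
  assumes C: "card C = 4" and F: "F \<subseteq> Pow C" and I: "\<And>S S'. S \<in> F \<Longrightarrow> S' \<in> F \<Longrightarrow> S \<inter> S' \<noteq> {}"
  shows "\<exists>t<3. \<exists>x\<in>C. F \<subseteq> maximal_family C (t, x)"
proof -
  have fin: "finite C" using C card.infinite by fastforce
  have finS: "finite S" if "S \<in> F" for S using that F fin finite_subset by blast
  show ?thesis
  proof (cases "\<exists>x. {x} \<in> F")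
    case True
    then obtain x where x: "{x} \<in> F" by auto
    then have "x \<in> C" "F \<subseteq> maximal_family C (0, x)" using F I[OF x] by auto
    then show ?thesis by (metis zero_less_numeral)
  next
    case False
    have two: "2 \<le> card S" if S: "S \<in> F" for S
    proof -
      have "card S \<noteq> 0" using I[OF S S] finS[OF S] by auto
      moreover have "card S \<noteq> 1" using False S by (metis card_1_singletonE)
      ultimately show ?thesis by linarith
    qed
    show ?thesis
    proof (cases "\<exists>x\<in>C. \<forall>S\<in>F. card S = 2 \<longrightarrow> x \<in> S")
      case True
      then obtain x where x: "x \<in> C" "\<forall>S\<in>F. card S = 2 \<longrightarrow> x \<in> S" by auto
      have "S \<in> maximal_family C (2, x)" if "S \<in> F" for S
        using x two[OF that] that by (cases "card S = 2") auto
      then show ?thesis using x(1) by (intro exI[of _ 2]) auto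
    next
      case no: False
      then have ex: "\<And>x. x \<in> C \<Longrightarrow> \<exists>S\<in>F. card S = 2 \<and> x \<notin> S" by blast
      have "C \<noteq> {}" using C by auto
      then obtain S1 where S1: "S1 \<in> F" "card S1 = 2" using ex by blast
      obtain a b where ab: "S1 = {a, b}" "a \<noteq> b" using S1 by (meson card_2_iff)
      have abC: "a \<in> C" "b \<in> C" using S1 ab F by auto
      obtain S2 where S2: "S2 \<in> F" "card S2 = 2" "a \<notin> S2" using ex abC by blast
      have "b \<in> S2" using I[OF S1(1) S2(1)] ab S2 by auto
      then obtain c where c: "S2 = {b, c}" "b \<noteq> c" using S2(2) by (metis card_2_iff insertE insert_commute singletonD)
      obtain S3 where S3: "S3 \<in> F" "card S3 = 2" "b \<notin> S3" using ex abC by blast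
      have "a \<in> S3" "c \<in> S3" using I[OF S1(1) S3(1)] I[OF S2(1) S3(1)] ab c S3 by auto
      have cC: "c \<in> C" "a \<noteq> c" using S2 c F by auto
      have d: "card {a, b, c} = 3" using ab c cC by auto
      have S3eq: "S3 = {a, c}"
        using \<open>a \<in> S3\<close> \<open>c \<in> S3\<close> S3(2) cC(2) by (metis card_2_iff insertE insert_commute singletonD)
      have "card (C - {a, b, c}) = 1" using d C abC cC fin by (subst card_Diff_subset) auto
      then obtain x where x: "C - {a, b, c} = {x}" by (meson card_1_singletonE)
      then have Cx: "C - {x} = {a, b, c}" "x \<in> C" using abC cC by auto
      have "S \<in> maximal_family C (1, x)" if S: "S \<in> F" for S
      proof -
        have "S \<inter> {a, b} \<noteq> {}" "S \<inter> {b, c} \<noteq> {}" "S \<inter> {a, c} \<noteq> {}"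
          using I[OF S S1(1)] I[OF S S2(1)] I[OF S S3(1)] ab c S3eq by auto
        then have "{a, b} \<subseteq> S \<inter> {a, b, c} \<or> {b, c} \<subseteq> S \<inter> {a, b, c} \<or> {a, c} \<subseteq> S \<inter> {a, b, c}" by auto
        then have "2 \<le> card (S \<inter> {a, b, c})"
          using card_mono[of "S \<inter> {a, b, c}" "{a, b}"] card_mono[of "S \<inter> {a, b, c}" "{b, c}"]
            card_mono[of "S \<inter> {a, b, c}" "{a, c}"] ab c cC by auto
        then show ?thesis using Cx by simp
      qed
      then show ?thesis using Cx(2) by (intro exI[of _ 1]) auto
    qed
  qed
qed

text \<open>Without triangles the sets \<open>A v u\<close> for a fixed \<open>v\<close> intersect
  pairwise. Vertices \<open>u\<close> and \<open>v\<close> with the same maximal family would put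
  the disjoint sets \<open>A u v\<close> and \<open>A v u\<close> into it.\<close>

lemma (in minimal_cover) impossible: False
proof -
  define F where "F v = (A v) ` (V - {v})" for v
  have inter: "S \<inter> S' \<noteq> {}" if v: "v \<in> V" and S: "S \<in> F v" "S' \<in> F v" for v S S'
  proof -
    obtain u u' where u: "u \<in> V - {v}" "u' \<in> V - {v}" "S = A v u" "S' = A v u'" using S F_def by auto
    show ?thesis
    proof (cases "u = u'")
      case True then show ?thesis using u A_nonempty[of v u] v by auto
    next
      case False
      then have d: "distinct [v, u, u']" using u by auto
      then show ?thesis using cover[of v u u'] no_triangles[of v u u'] u v by auto
    qed
  qed
  have "\<exists>g. fst g < 3 \<and> snd g \<in> C \<and> F v \<subseteq> maximal_family C g" if v: "v \<in> V" for v
  proof -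
    have "F v \<subseteq> Pow C" unfolding F_def using A_sub[of v] v by auto
    then obtain t x where "t < 3" "x \<in> C" "F v \<subseteq> maximal_family C (t, x)"
      using intersecting_family_extends[OF card_C, of "F v"] inter[OF v] by blast
    then show ?thesis by (intro exI[of _ "(t, x)"]) auto
  qed
  then obtain g where g: "\<And>v. v \<in> V \<Longrightarrow> fst (g v) < 3 \<and> snd (g v) \<in> C \<and> F v \<subseteq> maximal_family C (g v)" by metis
  have "inj_on g V"
  proof (rule inj_onI, rule ccontr)
    fix u v assume uv: "u \<in> V" "v \<in> V" "g u = g v" "u \<noteq> v"
    obtain t x where tx: "g v = (t, x)" by fastforce
    have "A u v \<in> F u" "A v u \<in> F v" using uv unfolding F_def by auto
    then have "A u v \<in> maximal_family C (t, x)" "A v u \<in> maximal_family C (t, x)"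
      using g[of u] g[of v] uv tx by auto
    then show False
      using maximal_family_intersecting[OF card_C, of x "A u v" "A v u" t] g[of v] tx uv A_sub[of u v] A_sub[of v u]
        A_disj[of u v] by auto
  qed
  moreover have "g ` V \<subseteq> {..<3} \<times> C" using g by (intro image_subsetI) (simp add: mem_Times_iff)
  ultimately have "card V \<le> card ({..<3::nat} \<times> C)" using fin_C by (intro card_inj_on_le) auto
  then show False using card_V card_C by (simp add: card_cartesian_product)
qed

lemma (in star_triangle_cover) saturate:
  "\<exists>A'. star_triangle_cover V C A' T \<and>
     (\<forall>u\<in>V. \<forall>v\<in>V. \<forall>c\<in>C. u \<noteq> v \<longrightarrow> c \<in> A' u v \<or> c \<in> A' v u \<or> (\<exists>w\<in>V - {u, v}. c \<in> T u v w))"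
proof -
  define A' where "A' u v = A u v \<union>
    (if u < v then {c \<in> C. c \<notin> A v u \<and> (\<forall>w\<in>V - {u, v}. c \<notin> T u v w)} else {})" for u v
  have "star_triangle_cover V C A' T"
  proof
    fix u v assume uv: "u \<in> V" "v \<in> V" "u \<noteq> v"
    show "A' u v \<subseteq> C" unfolding A'_def using A_sub uv by auto
    show "A' u v \<inter> A' v u = {}" unfolding A'_def using A_disj[OF uv] by auto
  next
    fix u v w assume uvw: "u \<in> V" "v \<in> V" "w \<in> V" "distinct [u, v, w]"
    show "T u v w \<subseteq> C" using T_sub uvw by auto
    show "T u v w \<inter> A' u v = {}" unfolding A'_def using T_A[OF uvw] uvw by auto
    show "A' u v \<inter> A' u w \<noteq> {} \<or> T u v w \<noteq> {}" unfolding A'_def using cover[OF uvw] by auto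
  qed (use card_V card_C T_T T_swap T_rot in blast)+
  moreover have "c \<in> A' u v \<or> c \<in> A' v u \<or> (\<exists>w\<in>V - {u, v}. c \<in> T u v w)"
    if "u \<in> V" "v \<in> V" "c \<in> C" "u \<noteq> v" for u v c
  proof (cases "u < v")
    case True then show ?thesis using that unfolding A'_def by auto
  next
    case False
    then have "v < u" using that by auto
    then show ?thesis using that T_swap[of u v] unfolding A'_def by auto
  qed
  ultimately show ?thesis by blast
qed

lemma no_star_triangle_cover: "\<not> star_triangle_cover V C A T"
proof
  assume "star_triangle_cover V C A T"
  then obtain A1 T1 where 1: "star_triangle_cover V C A1 T1"
    and least: "\<And>A' T'. star_triangle_cover V C A' T' \<Longrightarrow> card (triangles V T1) \<le> card (triangles V T')"
    using ex_has_least_nat[of "\<lambda>(A, T). star_triangle_cover V C A T" "(A, T)" "\<lambda>(A, T). card (triangles V T)"]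
    by auto
  interpret star_triangle_cover V C A1 T1 using 1 .
  obtain A2 where 2: "star_triangle_cover V C A2 T1" and
    sat: "\<forall>u\<in>V. \<forall>v\<in>V. \<forall>c\<in>C. u \<noteq> v \<longrightarrow> c \<in> A2 u v \<or> c \<in> A2 v u \<or> (\<exists>w\<in>V - {u, v}. c \<in> T1 u v w)"
    using saturate by blast
  have "minimal_cover V C A2 T1"
    by (intro minimal_cover.intro minimal_cover_axioms.intro) (use 2 least sat in blast)+
  then show False by (rule minimal_cover.impossible)
qed

section \<open>Matroids\<close>

text \<open>Otherwise \<open>{f}\<close> and \<open>{e, g}\<close> would both be maximal members
  within \<open>{e, f, g}\<close>.\<close>

lemma matroid_parallel_trans:
  assumes M: "matroid_on E M" and sing: "{e} \<in> M" "{f} \<in> M" "{g} \<in> M"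
    and ef: "e = f \<or> {e, f} \<notin> M" and fg: "f = g \<or> {f, g} \<notin> M"
  shows "e = g \<or> {e, g} \<notin> M"
proof (rule ccontr)
  assume n: "\<not> (e = g \<or> {e, g} \<notin> M)"
  then have eg: "e \<noteq> g" "{e, g} \<in> M" by auto
  then have ne: "e \<noteq> f" "f \<noteq> g" using ef fg by (auto simp: insert_commute)
  have sub: "J \<in> M" if "I \<in> M" "J \<subseteq> I" for I J using M that unfolding matroid_on_def by blast
  have notin: "{e, f} \<notin> M" "{f, g} \<notin> M" using ef fg ne by auto
  have A: "{e, f, g} \<subseteq> E" using M sing unfolding matroid_on_def by auto
  have "maximal_member_in M {e, f, g} {f}"
    unfolding maximal_member_in_def
  proof (intro conjI ballI impI)
    fix J assume J: "J \<in> M" "{f} \<subseteq> J \<and> J \<subseteq> {e, f, g}"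
    have "e \<notin> J" using sub[OF J(1), of "{e, f}"] notin J by auto
    moreover have "g \<notin> J" using sub[OF J(1), of "{f, g}"] notin J by auto
    ultimately show "J = {f}" using J by auto
  qed (use sing in auto)
  moreover have "maximal_member_in M {e, f, g} {e, g}"
    unfolding maximal_member_in_def
  proof (intro conjI ballI impI)
    fix J assume J: "J \<in> M" "{e, g} \<subseteq> J \<and> J \<subseteq> {e, f, g}"
    have "f \<notin> J" using sub[OF J(1), of "{e, f}"] notin J by auto
    then show "J = {e, g}" using J by auto
  qed (use eg in auto)
  ultimately have "card {f} = card {e, g}" using M A unfolding matroid_on_def by blast
  then show False using eg by auto
qed

section \<open>Lower bound: four matroids fail on thirteen vertices\<close>

definition complete_graph :: "'v set \<Rightarrow> 'v graph" where
  "complete_graph V = (V, {e. e \<subseteq> V \<and> card e = 2})"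

lemma edge_complete_graph:
  "u \<in> V \<Longrightarrow> v \<in> V \<Longrightarrow> u \<noteq> v \<Longrightarrow> {u, v} \<in> edges (complete_graph V)"
  unfolding complete_graph_def edges_def by auto

lemma complete_graph_needs_five_matroids:
  fixes V :: "'v :: linorder set" and M :: "nat \<Rightarrow> 'v set set set"
  assumes V: "card V \<ge> 13" and m: "1 \<le> m" "m \<le> 4"
    and M: "\<forall>i\<in>{1..m}. matroid_on (edges (complete_graph V)) (M i)"
    and eq: "matchings (complete_graph V) = (\<Inter>i\<in>{1..m}. M i)"
  shows False
proof -
  define K where "K = complete_graph V"
  \<comment> \<open>Repeating the last matroid turns \<open>m\<close> matroids into exactly four
    without changing the intersection.\<close>
  define N where "N c = M (min c m)" for c
  define C where "C = {1..4::nat}"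
  have mat: "matroid_on (edges K) (N c)" if "c \<in> C" for c
    using M that m unfolding N_def C_def K_def by auto
  have matching: "F \<in> N c" if "c \<in> C" "F \<in> matchings K" for c F
    using that m eq unfolding N_def C_def K_def by auto
  have E: "{u, v} \<in> edges K" if "u \<in> V" "v \<in> V" "u \<noteq> v" for u v
    unfolding K_def using that by (rule edge_complete_graph)
  define par where "par c e f \<longleftrightarrow> e = f \<or> {e, f} \<notin> N c" for c e f
  have sym: "par c e f \<longleftrightarrow> par c f e" for c e f unfolding par_def by (auto simp: insert_commute)
  have sing: "{e} \<in> N c" if "c \<in> C" "e \<in> edges K" for c e
    using matching[of c "{e}"] that unfolding matchings_def by auto
  have trans: "par c e g"
    if "c \<in> C" "e \<in> edges K" "f \<in> edges K" "g \<in> edges K" "par c e f" "par c f g" for c e f g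
    using matroid_parallel_trans[OF mat, of c e f g] sing that unfolding par_def by auto
  have meet: "e \<inter> f \<noteq> {}" if "c \<in> C" "e \<in> edges K" "f \<in> edges K" "par c e f" for c e f
  proof
    assume d: "e \<inter> f = {}"
    have "e \<noteq> {}" using that(2) unfolding K_def complete_graph_def edges_def by auto
    then have "e \<noteq> f" using d by auto
    moreover have "{e, f} \<in> matchings K" unfolding matchings_def
      using that d by (auto simp: pairwise_def disjnt_def)
    ultimately show False using matching[of c] that unfolding par_def by auto
  qed
  have adj: "\<exists>c\<in>C. par c e f" if ef: "e \<in> edges K" "f \<in> edges K" "e \<noteq> f" "e \<inter> f \<noteq> {}" for e f
  proof -
    have "{e, f} \<notin> matchings K" using ef unfolding matchings_def by (auto simp: pairwise_def disjnt_def)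
    then obtain c where "c \<in> {1..m}" "{e, f} \<notin> M c" using eq unfolding K_def by auto
    then have "c \<in> C" "par c e f" using m unfolding par_def N_def C_def by (auto simp: min_absorb1)
    then show ?thesis by auto
  qed
  \<comment> \<open>The witness \<open>w\<close> excludes classes that consist of \<open>uv\<close>
    alone or form a triangle, so that the centre \<open>u\<close> is determined.\<close>
  define A where "A u v = {c \<in> C. \<exists>w\<in>V - {u, v}. par c {u, v} {u, w} \<and> \<not> par c {u, v} {v, w}}" for u v
  define T where "T u v w = {c \<in> C. par c {u, v} {u, w} \<and> par c {u, v} {v, w} \<and> par c {u, w} {v, w}}" for u v w
  have "star_triangle_cover V C A T"
  proof
    show "13 \<le> card V" "card C = 4" using V unfolding C_def by auto
  next
    fix u v assume uv: "u \<in> V" "v \<in> V" "u \<noteq> v"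
    show "A u v \<subseteq> C" unfolding A_def by auto
    show "A u v \<inter> A v u = {}"
    proof (rule ccontr)
      assume "A u v \<inter> A v u \<noteq> {}"
      then obtain c w w' where c: "c \<in> C" and w: "w \<in> V - {u, v}" "par c {u, v} {u, w}" "\<not> par c {u, v} {v, w}"
        and w': "w' \<in> V - {u, v}" "par c {u, v} {v, w'}" "\<not> par c {u, v} {u, w'}"
        unfolding A_def by (auto simp: insert_commute)
      have "par c {u, w} {v, w'}" using trans[of c "{u, w}" "{u, v}" "{v, w'}"] sym[of c] c w w' uv E by auto
      then have "{u, w} \<inter> {v, w'} \<noteq> {}" using meet[of c "{u, w}" "{v, w'}"] c w w' uv E by auto
      then have "w = w'" using w w' uv by auto
      then show False using w w' by auto
    qed
  next
    fix u v w assume V: "u \<in> V" "v \<in> V" "w \<in> V" and d: "distinct [u, v, w]"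
    show "T u v w \<subseteq> C" unfolding T_def by auto
    show "T u v w \<inter> A u v = {}"
    proof (rule ccontr)
      assume "T u v w \<inter> A u v \<noteq> {}"
      then obtain c x where c: "c \<in> C" and w: "par c {u, v} {v, w}"
        and x: "x \<in> V - {u, v}" "par c {u, v} {u, x}" "\<not> par c {u, v} {v, x}"
        unfolding A_def T_def by auto
      have "par c {u, x} {v, w}" using trans[of c "{u, x}" "{u, v}" "{v, w}"] sym[of c] c w x V d E by auto
      then have "{u, x} \<inter> {v, w} \<noteq> {}" using meet[of c "{u, x}" "{v, w}"] c w x V d E by auto
      then have "x = w" using x V d by auto
      then show False using w x by auto
    qed
    have e: "{u, v} \<in> edges K" "{u, w} \<in> edges K" "{v, w} \<in> edges K" using E V d by auto
    obtain c where c: "c \<in> C" "par c {u, v} {u, w}"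
      using adj[OF e(1,2)] d by (auto simp: doubleton_eq_iff)
    \<comment> \<open>If \<open>vw\<close> is in the class of \<open>uv\<close> as well, the class
      is a triangle. Otherwise \<open>w\<close> is the witness for \<open>A u v\<close>, and
      \<open>v\<close> is the witness for \<open>A u w\<close>.\<close>
    show "A u v \<inter> A u w \<noteq> {} \<or> T u v w \<noteq> {}"
    proof (cases "par c {u, v} {v, w}")
      case True
      then have "par c {u, w} {v, w}" using trans[of c "{u, w}" "{u, v}" "{v, w}"] sym[of c] c e by auto
      then show ?thesis using True c unfolding T_def by auto
    next
      case False
      then have "\<not> par c {u, w} {v, w}" using trans[of c "{u, v}" "{u, w}" "{v, w}"] c e by auto
      then have "c \<in> A u v" "c \<in> A u w"
        using False c sym[of c "{u, v}" "{u, w}"] V d unfolding A_def by (auto simp: insert_commute)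
      then show ?thesis by auto
    qed
  next
    fix u v w x assume V: "u \<in> V" "v \<in> V" "w \<in> V" "x \<in> V" and d: "distinct [u, v, w, x]"
    show "T u v w \<inter> T u v x = {}"
    proof (rule ccontr)
      assume "T u v w \<inter> T u v x \<noteq> {}"
      then obtain c where c: "c \<in> C" "par c {u, v} {u, w}" "par c {u, v} {v, x}" unfolding T_def by auto
      then have "par c {u, w} {v, x}" using trans[of c "{u, w}" "{u, v}" "{v, x}"] sym[of c] V d E by auto
      then show False using meet[of c "{u, w}" "{v, x}"] c V d E by auto
    qed
  next
    fix u v w
    have *: "{v, u} = {u, v}" "{w, v} = {v, w}" for u v w :: 'v by auto
    show "T u v w = T v u w" unfolding T_def using sym[of _ "{u, w}" "{v, w}"] by (auto simp: *(1)[of v u])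
    show "T u v w = T u w v" unfolding T_def using sym[of _ "{u, v}" "{u, w}"] by (auto simp: *(2)[of w v])
  qed
  then show False using no_star_triangle_cover by auto
qed

section \<open>Upper bound: five partition matroids for at most sixteen vertices\<close>

lemma partition_matroid:
  assumes "finite E"
  shows "matroid_on E {F. F \<subseteq> E \<and> inj_on f F}"
proof -
  have "card I = card (f ` A)" if A: "A \<subseteq> E" and I: "maximal_member_in {F. F \<subseteq> E \<and> inj_on f F} A I" for A I
  proof -
    have I': "I \<subseteq> A" "inj_on f I" "\<And>J. J \<subseteq> E \<Longrightarrow> inj_on f J \<Longrightarrow> I \<subseteq> J \<Longrightarrow> J \<subseteq> A \<Longrightarrow> J = I"
      using I unfolding maximal_member_in_def by auto
    \<comment> \<open>A maximal member picks one element from every class that meets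
      \<open>A\<close>, since an element of a missed class could be added.\<close>
    have "f a \<in> f ` I" if a: "a \<in> A" for a
    proof (rule ccontr)
      assume n: "f a \<notin> f ` I"
      then have "inj_on f (insert a I)" using I'(2) by auto
      then have "insert a I = I" using I'(3)[of "insert a I"] I'(1) A a by blast
      then show False using n by auto
    qed
    then have "f ` I = f ` A" using I'(1) by auto
    then show ?thesis using card_image[OF I'(2)] by simp
  qed
  then show ?thesis unfolding matroid_on_def using assms by (auto intro: inj_on_subset)
qed

text \<open>\<open>s c e\<close> is the centre of the star of \<open>e\<close> in partition
  \<open>c\<close>. Disjoint edges never share a centre, while two edges meeting in \<open>v\<close>
  share it in some partition.\<close>

lemma matchings_eq_Inter_star_partitions:
  assumes I: "I \<noteq> {}"
    and centre: "\<And>c e. c \<in> I \<Longrightarrow> e \<in> edges G \<Longrightarrow> s c e \<in> e"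
    and common: "\<And>e f v. \<lbrakk>e \<in> edges G; f \<in> edges G; e \<noteq> f; v \<in> e; v \<in> f\<rbrakk> \<Longrightarrow> \<exists>c\<in>I. s c e = v \<and> s c f = v"
  shows "matchings G = (\<Inter>c\<in>I. {F. F \<subseteq> edges G \<and> inj_on (s c) F})"
proof
  show "matchings G \<subseteq> (\<Inter>c\<in>I. {F. F \<subseteq> edges G \<and> inj_on (s c) F})"
  proof (rule subsetI, rule INT_I, rule CollectI, rule conjI)
    fix F c assume F: "F \<in> matchings G" and c: "c \<in> I"
    show sub: "F \<subseteq> edges G" using F unfolding matchings_def by auto
    show "inj_on (s c) F"
    proof (rule inj_onI, rule ccontr)
      fix e f assume ef: "e \<in> F" "f \<in> F" "s c e = s c f" "e \<noteq> f"
      then have "disjnt e f" using F unfolding matchings_def pairwise_def by auto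
      moreover have "s c e \<in> e" "s c f \<in> f" using centre[OF c] ef sub by blast+
      ultimately show False using ef(3) unfolding disjnt_def by auto
    qed
  qed
  show "(\<Inter>c\<in>I. {F. F \<subseteq> edges G \<and> inj_on (s c) F}) \<subseteq> matchings G"
  proof
    fix F assume F: "F \<in> (\<Inter>c\<in>I. {F. F \<subseteq> edges G \<and> inj_on (s c) F})"
    then have sub: "F \<subseteq> edges G" using I by auto
    have "disjnt e f" if ef: "e \<in> F" "f \<in> F" "e \<noteq> f" for e f
    proof (rule ccontr)
      assume "\<not> disjnt e f"
      then obtain v where "v \<in> e" "v \<in> f" unfolding disjnt_def by auto
      then obtain c where "c \<in> I" "s c e = v" "s c f = v" using common[of e f v] ef sub by auto
      then show False using F ef by (auto simp: inj_on_def)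
    qed
    then show "F \<in> matchings G" using sub unfolding matchings_def pairwise_def by auto
  qed
qed

text \<open>\<open>S\<close> takes all of \<open>W - W'\<close>, which costs nothing in
  \<open>W'\<close>, and then only as many common elements as a majority in \<open>W\<close> still
  requires.\<close>

lemma separating_majority_aux:
  assumes fin: "finite W" "finite W'" and odd: "odd (card W)" "odd (card W')" and ne: "\<not> W \<subseteq> W'"
  shows "\<exists>S. card W < 2 * card (S \<inter> W) \<and> card W' < 2 * card (W' - S)"
proof -
  obtain a where a: "card W = 2 * a + 1" using odd(1) by (rule oddE)
  obtain b where b: "card W' = 2 * b + 1" using odd(2) by (rule oddE)
  define t where "t = card (W - W')"
  have t: "t \<ge> 1" using ne fin unfolding t_def by (simp add: Suc_le_eq card_gt_0_iff)
  have WW: "card (W \<inter> W') + t = 2 * a + 1"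
    unfolding t_def a[symmetric] using fin card_Int_Diff[of W W'] by simp
  have le: "card (W \<inter> W') \<le> 2 * b + 1" unfolding b[symmetric] using fin by (intro card_mono) auto
  have "a + 1 - t \<le> card (W \<inter> W')" using WW by linarith
  then obtain P where P: "P \<subseteq> W \<inter> W'" "card P = a + 1 - t" by (meson obtain_subset_with_card_n)
  define S where "S = (W - W') \<union> P"
  have finP: "finite P" using P fin finite_subset by blast
  have "card S = t + (a + 1 - t)"
    unfolding S_def t_def[symmetric] P(2)[symmetric] using P fin finP t_def by (subst card_Un_disjoint) auto
  moreover have "S \<inter> W = S" "W' - S = W' - P" "S \<subseteq> W" unfolding S_def using P by auto
  moreover have "card (W' - P) = 2 * b + 1 - (a + 1 - t)"
    using P finP b by (subst card_Diff_subset) auto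
  \<comment> \<open>Oddness and \<open>t >= 1\<close> keep the number of common elements used below
    a majority of \<open>W'\<close>. Truncated subtraction covers the case that
    \<open>W - W'\<close> alone is large enough.\<close>
  moreover have "a + 1 - t \<le> b" using t WW le by linarith
  ultimately show ?thesis
    using a b by (intro exI[of _ S]) auto
qed

lemma separating_majority:
  assumes fin: "finite W" "finite W'" and odd: "odd (card W)" "odd (card W')" and ne: "W \<noteq> W'"
  shows "\<exists>S. card W < 2 * card (W \<inter> S) \<and> card W' < 2 * card (W' - S)"
proof (cases "W \<subseteq> W'")
  case False
  then show ?thesis using separating_majority_aux[OF fin odd] by (auto simp: Int_commute)
next
  case True
  then have "\<not> W' \<subseteq> W" using ne by auto
  then obtain S where "card W' < 2 * card (S \<inter> W')" "card W < 2 * card (W - S)"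
    using separating_majority_aux[OF fin(2,1) odd(2,1)] by auto
  moreover have "W' - (- S) = S \<inter> W'" "W \<inter> - S = W - S" by auto
  ultimately show ?thesis by (intro exI[of _ "- S"]) simp
qed

text \<open>Each vertex gets its own set of odd size among five colours. Majorities in a common set meet, and
  two different odd sets are separated by some S with a majority in one whose complement has a
  majority in the other; S is the set of colours for which the edge belongs to the first star.\<close>

lemma five_matroids_suffice:
  fixes G :: "nat graph"
  assumes G: "finite_simple_graph G" and card: "card (verts G) \<le> 16"
  shows "\<exists>M :: nat \<Rightarrow> nat set set set.
    (\<forall>i\<in>{1..5}. matroid_on (edges G) (M i)) \<and> matchings G = (\<Inter>i\<in>{1..5}. M i)"
proof -
  have finV: "finite (verts G)" using G unfolding finite_simple_graph_def by auto
  \<comment> \<open>Sixteen labels: subsets of \<open>{1..4}\<close> correspond to odd subsets of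
    \<open>{1..5}\<close> by adding 5 exactly when the size is even.\<close>
  have "card (Pow {1..4::nat}) = 16" by (simp add: card_Pow)
  then obtain h where h: "h ` verts G \<subseteq> Pow {1..4::nat}" "inj_on h (verts G)"
    using inj_on_iff_card_le[OF finV, of "Pow {1..4::nat}"] card by auto
  define W where "W v = (if odd (card (h v)) then h v else insert 5 (h v))" for v
  have hv: "h v \<subseteq> {1..4}" "finite (h v)" "5 \<notin> h v" if "v \<in> verts G" for v
  proof -
    show "h v \<subseteq> {1..4}" using h that by auto
    then show "finite (h v)" "5 \<notin> h v" using finite_subset by auto
  qed
  have W: "W v \<subseteq> {1..5}" "odd (card (W v))" "finite (W v)" "W v - {5} = h v" if "v \<in> verts G" for v
    using hv[OF that] unfolding W_def by auto
  have W_inj: "W u \<noteq> W v" if "u \<in> verts G" "v \<in> verts G" "u \<noteq> v" for u v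
    using W(4)[OF that(1)] W(4)[OF that(2)] h(2) that by (metis inj_onD)
  have "\<exists>S. card (W u) < 2 * card (W u \<inter> S) \<and> card (W v) < 2 * card (W v - S)"
    if "u \<in> verts G" "v \<in> verts G" "u \<noteq> v" for u v
    using separating_majority[of "W u" "W v"] W W_inj that by auto
  then obtain S where S: "\<And>u v. \<lbrakk>u \<in> verts G; v \<in> verts G; u \<noteq> v\<rbrakk>
      \<Longrightarrow> card (W u) < 2 * card (W u \<inter> S u v) \<and> card (W v) < 2 * card (W v - S u v)" by metis
  \<comment> \<open>\<open>S u v\<close> depends on the order of the ends, so \<open>Min\<close> and
    \<open>Max\<close> fix one; the larger end receives the complement.\<close>
  define s where "s c e = (if c \<in> S (Min e) (Max e) then Min e else Max e)" for c :: nat and e :: "nat set"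
  have majority: "card (W u) < 2 * card {c \<in> W u. s c {u, v} = u}"
    if uv: "u \<in> verts G" "v \<in> verts G" "u \<noteq> v" for u v
  proof (cases "u < v")
    case True
    then have "{c \<in> W u. s c {u, v} = u} = W u \<inter> S u v" unfolding s_def by (auto simp: min_def max_def)
    then show ?thesis using S[OF uv] by simp
  next
    case False
    then have "{c \<in> W u. s c {u, v} = u} = W u - S v u" unfolding s_def using uv by (auto simp: min_def max_def)
    then show ?thesis using S[of v u] uv by simp
  qed
  have edge: "\<exists>u v. e = {u, v} \<and> u \<noteq> v \<and> u \<in> verts G \<and> v \<in> verts G" if "e \<in> edges G" for e
  proof -
    have "e \<subseteq> verts G" "card e = 2" using G that unfolding finite_simple_graph_def by auto
    then show ?thesis by (auto simp: card_2_iff)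
  qed
  have edge_at: "\<exists>u. e = {v, u} \<and> u \<noteq> v \<and> u \<in> verts G \<and> v \<in> verts G" if "e \<in> edges G" "v \<in> e" for e v
    using edge[OF that(1)] that(2) by (auto simp: insert_commute)
  have eq: "matchings G = (\<Inter>c\<in>{1..5}. {F. F \<subseteq> edges G \<and> inj_on (s c) F})"
  proof (rule matchings_eq_Inter_star_partitions)
    show "s c e \<in> e" if "e \<in> edges G" for c e
      using edge[OF that] Min_in[of e] Max_in[of e] unfolding s_def by auto
  next
    fix e f v assume ef: "e \<in> edges G" "f \<in> edges G" "e \<noteq> f" "v \<in> e" "v \<in> f"
    obtain a where a: "e = {v, a}" "a \<noteq> v" "a \<in> verts G" "v \<in> verts G" using edge_at ef by blast
    obtain b where b: "f = {v, b}" "b \<noteq> v" "b \<in> verts G" using edge_at ef by blast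
    let ?P = "{c \<in> W v. s c e = v}" and ?Q = "{c \<in> W v. s c f = v}"
    have "?P \<inter> ?Q \<noteq> {}"
    proof
      assume d: "?P \<inter> ?Q = {}"
      have "card ?P + card ?Q = card (?P \<union> ?Q)" using d W(3)[OF a(4)] by (subst card_Un_disjoint) auto
      also have "\<dots> \<le> card (W v)" using W(3)[OF a(4)] by (intro card_mono) auto
      finally show False using majority[of v a] majority[of v b] a b by auto
    qed
    then show "\<exists>c\<in>{1..5}. s c e = v \<and> s c f = v" using W(1)[OF a(4)] by auto
  qed auto
  have "finite (edges G)"
    using G finV finite_subset[of "edges G" "Pow (verts G)"] unfolding finite_simple_graph_def by auto
  then show ?thesis using eq partition_matroid by (intro exI[of _ "\<lambda>c. {F. F \<subseteq> edges G \<and> inj_on (s c) F}"]) auto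
qed

theorem theorem8:
  fixes n :: nat
  assumes "n \<in> {13, 14, 15}"
  shows "mu n = 5"
proof -
  let ?P = "\<lambda>(G :: nat graph) m. m \<ge> 1 \<and>
    (\<exists>M :: nat \<Rightarrow> nat set set set. (\<forall>i\<in>{1..m}. matroid_on (edges G) (M i)) \<and> matchings G = (\<Inter>i\<in>{1..m}. M i))"
  have five: "?P G 5" if "finite_simple_graph G" "card (verts G) \<le> n" for G :: "nat graph"
    using five_matroids_suffice[of G] that assms by auto
  have upper: "mu_graph G \<le> 5" if "finite_simple_graph G" "card (verts G) \<le> n" for G :: "nat graph"
    unfolding mu_graph_def by (rule Least_le) (rule five[OF that])
  \<comment> \<open>The complete graph on 13 vertices is admissible for all three values of
    \<open>n\<close>.\<close>
  define K where "K = complete_graph {..<13::nat}"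
  have K: "finite_simple_graph K" "card (verts K) \<le> n"
    using assms unfolding K_def complete_graph_def finite_simple_graph_def verts_def edges_def by auto
  have "?P K (mu_graph K)" unfolding mu_graph_def by (rule LeastI) (rule five[OF K])
  then have "mu_graph K = 5"
    using upper[OF K] complete_graph_needs_five_matroids[of "{..<13::nat}" "mu_graph K"] unfolding K_def
    by (cases "mu_graph K \<le> 4") (auto simp: K_def)
  then have "5 \<in> {mu_graph G | G :: nat graph. finite_simple_graph G \<and> card (verts G) \<le> n}"
    using K by (intro CollectI exI[of _ K]) auto
  moreover have "finite {mu_graph G | G :: nat graph. finite_simple_graph G \<and> card (verts G) \<le> n}"
    by (rule finite_subset[of _ "{..5}"]) (use upper in auto)
  ultimately show ?thesis unfolding mu_def using upper by (intro Max_eqI) auto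
qed

end
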